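(* Let $\mathsf{M}$ be a matroid. If $\mathsf{M}$ is a direct sum of loops, coloops, and snake matroids, then its base polytope $\mathscr{P}(\mathsf{M})$ is Ehrhart positive.
   Context: For a matroid $\mathsf{M}$ on ground set $\{1,\dots,n\}$ with set of bases $\mathcal{B}$, the base polytope is $\mathscr{P}(\mathsf{M})=\mathrm{conv}(e_B: B\in\mathcal{B})\subseteq\mathbb{R}^n$, where $e_B=\sum_{i\in B}e_i$. A lattice path matroid is defined as follows: fix lattice paths $P,Q$ from $(0,0)$ to $(m,r)$ using unit north and east steps with $P$ never going above $Q$; the ground set is $\{1,\dots,m+r\}$ and the bases are the sets of positions of the north steps of the lattice paths from $(0,0)$ to $(m,r)$ that stay weakly between $P$ and $Q$. A snake matroid is a matroid that (i) has at least two elements and is connected, (ii) is isomorphic to a lattice path matroid, and (iii) has no minor isomorphic to the uniform matroid $\mathsf{U}_{2,4}$, i.e. is binary. The Ehrhart polynomial of a lattice polytope $\mathscr{P}\subseteq\mathbb{R}^n$ is the unique polynomial $\mathrm{ehr}(\mathscr{P},t)\in\mathbb{Q}[t]$ with $\mathrm{ehr}(\mathscr{P},t)=\#(t\mathscr{P}\cap\mathbb{Z}^n)$ for all positive integers $t$; $\mathscr{P}$ is Ehrhart positive if all coefficients of $\mathrm{ehr}(\mathscr{P},t)$ are nonnegative. *)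

theory Defs
  imports "HOL-Analysis.Analysis" "HOL-Computational_Algebra.Polynomial"
begin

subsection \<open>Matroids, given by their bases\<close>

record 'a matroid_data =
  ground :: "'a set"
  bases :: "'a set set"

definition matroid :: "'a matroid_data \<Rightarrow> bool" where
  "matroid M \<longleftrightarrow>
     finite (ground M) \<and>
     bases M \<noteq> {} \<and>
     (\<forall>B\<in>bases M. B \<subseteq> ground M) \<and>
     (\<forall>A\<in>bases M. \<forall>B\<in>bases M. \<forall>x\<in>A - B. \<exists>y\<in>B - A. insert y (A - {x}) \<in> bases M)"

definition indep :: "'a matroid_data \<Rightarrow> 'a set \<Rightarrow> bool" where
  "indep M I \<longleftrightarrow> (\<exists>B\<in>bases M. I \<subseteq> B)"

definition isomorphic :: "'a matroid_data \<Rightarrow> 'b matroid_data \<Rightarrow> bool" where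
  "isomorphic M N \<longleftrightarrow>
     (\<exists>f. bij_betw f (ground M) (ground N) \<and> bases N = (\<lambda>B. f ` B) ` bases M)"

definition uniform_matroid :: "nat \<Rightarrow> nat \<Rightarrow> nat matroid_data" where
  "uniform_matroid k n = \<lparr>ground = {1..n}, bases = {B. B \<subseteq> {1..n} \<and> card B = k}\<rparr>"


subsection \<open>Minors\<close>

definition dual :: "'a matroid_data \<Rightarrow> 'a matroid_data" where
  "dual M = \<lparr>ground = ground M, bases = (\<lambda>B. ground M - B) ` bases M\<rparr>"

definition delete :: "'a matroid_data \<Rightarrow> 'a set \<Rightarrow> 'a matroid_data" where
  "delete M X =
     \<lparr>ground = ground M - X,
      bases = {I. indep M I \<and> I \<subseteq> ground M - X \<and>
                  (\<forall>J. indep M J \<and> J \<subseteq> ground M - X \<and> I \<subseteq> J \<longrightarrow> J = I)}\<rparr>"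

definition contract :: "'a matroid_data \<Rightarrow> 'a set \<Rightarrow> 'a matroid_data" where
  "contract M X = dual (delete (dual M) X)"

definition is_minor :: "'a matroid_data \<Rightarrow> 'a matroid_data \<Rightarrow> bool" where
  "is_minor N M \<longleftrightarrow>
     (\<exists>X Y. X \<subseteq> ground M \<and> Y \<subseteq> ground M \<and> X \<inter> Y = {} \<and> N = delete (contract M X) Y)"


subsection \<open>Direct sums and connectedness\<close>

text \<open>Only meaningful when the two ground sets are disjoint; disjointness is required
  wherever the sum is used.\<close>

definition direct_sum :: "'a matroid_data \<Rightarrow> 'a matroid_data \<Rightarrow> 'a matroid_data" where
  "direct_sum M N =
     \<lparr>ground = ground M \<union> ground N, bases = {A \<union> B | A B. A \<in> bases M \<and> B \<in> bases N}\<rparr>"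

definition empty_matroid :: "'a matroid_data" where
  "empty_matroid = \<lparr>ground = {}, bases = {{}}\<rparr>"

definition is_direct_sum_of :: "'a matroid_data \<Rightarrow> 'a matroid_data list \<Rightarrow> bool" where
  "is_direct_sum_of M Ns \<longleftrightarrow>
     sorted_wrt (\<lambda>N N'. ground N \<inter> ground N' = {}) Ns \<and>
     M = foldr direct_sum Ns empty_matroid"

definition connected_matroid :: "'a matroid_data \<Rightarrow> bool" where
  "connected_matroid M \<longleftrightarrow>
     \<not> (\<exists>M1 M2. matroid M1 \<and> matroid M2 \<and> ground M1 \<noteq> {} \<and> ground M2 \<noteq> {} \<and>
                ground M1 \<inter> ground M2 = {} \<and> M = direct_sum M1 M2)"

definition is_loop :: "'a matroid_data \<Rightarrow> bool" where
  "is_loop M \<longleftrightarrow> (\<exists>e. M = \<lparr>ground = {e}, bases = {{}}\<rparr>)"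

definition is_coloop :: "'a matroid_data \<Rightarrow> bool" where
  "is_coloop M \<longleftrightarrow> (\<exists>e. M = \<lparr>ground = {e}, bases = {{e}}\<rparr>)"


subsection \<open>Lattice path matroids and snakes\<close>

datatype step = North | East

definition lattice_paths :: "nat \<Rightarrow> nat \<Rightarrow> step list set" where
  "lattice_paths m r = {w. count_list w East = m \<and> count_list w North = r}"

text \<open>After \<open>k\<close> steps, two paths starting at the origin both lie on the antidiagonal
  \<open>x + y = k\<close>. So one path never goes above another iff after each number of steps its
  height, the number of north steps made so far, is at most that of the other.\<close>

definition weakly_below :: "step list \<Rightarrow> step list \<Rightarrow> bool" where
  "weakly_below P Q \<longleftrightarrow> (\<forall>k. count_list (take k P) North \<le> count_list (take k Q) North)"

text \<open>Positions in a path are numbered from 1, whereas list indices start at 0.\<close>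

definition north_positions :: "step list \<Rightarrow> nat set" where
  "north_positions w = {i \<in> {1..length w}. w ! (i - 1) = North}"

definition lattice_path_matroid ::
    "nat \<Rightarrow> nat \<Rightarrow> step list \<Rightarrow> step list \<Rightarrow> nat matroid_data" where
  "lattice_path_matroid m r P Q =
     \<lparr>ground = {1..m + r},
      bases = north_positions ` {R \<in> lattice_paths m r. weakly_below P R \<and> weakly_below R Q}\<rparr>"

definition is_lattice_path_matroid :: "nat matroid_data \<Rightarrow> bool" where
  "is_lattice_path_matroid M \<longleftrightarrow>
     (\<exists>m r P Q. P \<in> lattice_paths m r \<and> Q \<in> lattice_paths m r \<and> weakly_below P Q \<and>
                M = lattice_path_matroid m r P Q)"

definition snake_matroid :: "'a matroid_data \<Rightarrow> bool" where
  "snake_matroid M \<longleftrightarrow>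
     matroid M \<and>
     card (ground M) \<ge> 2 \<and> connected_matroid M \<and>
     (\<exists>L. is_lattice_path_matroid L \<and> isomorphic M L) \<and>
     \<not> (\<exists>N. is_minor N M \<and> isomorphic N (uniform_matroid 2 4))"


subsection \<open>Base polytopes\<close>

text \<open>The ground set may be any subset \<open>E\<close> of the finite index type, so that the empty matroid
  is included. The polytope then lies in the coordinate subspace belonging to \<open>E\<close>;
  the other coordinates are 0 and do not affect the count of lattice points.\<close>

definition base_polytope :: "('n::finite) matroid_data \<Rightarrow> (real ^ 'n) set" where
  "base_polytope M = convex hull ((\<lambda>B. \<Sum>i\<in>B. axis i 1) ` bases M)"


subsection \<open>Ehrhart polynomials\<close>

definition integer_points :: "(real ^ 'n) set" where
  "integer_points = {x. \<forall>i. x $ i \<in> \<int>}"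

definition is_ehrhart_polynomial :: "(real ^ 'n) set \<Rightarrow> rat poly \<Rightarrow> bool" where
  "is_ehrhart_polynomial P p \<longleftrightarrow>
     (\<forall>t::nat. t > 0 \<longrightarrow>
        poly p (of_nat t) = of_nat (card ((\<lambda>x. real t *\<^sub>R x) ` P \<inter> integer_points)))"

definition ehrhart_polynomial :: "(real ^ 'n) set \<Rightarrow> rat poly" where
  "ehrhart_polynomial P = (THE p. is_ehrhart_polynomial P p)"

definition ehrhart_positive :: "(real ^ 'n) set \<Rightarrow> bool" where
  "ehrhart_positive P \<longleftrightarrow> (\<forall>i. coeff (ehrhart_polynomial P) i \<ge> 0)"

lemma is_ehrhart_polynomial_unique:
  assumes "is_ehrhart_polynomial P p" "is_ehrhart_polynomial P q"
  shows "p = q"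
proof (rule ccontr)
  assume "p \<noteq> q"
  then have "finite {x. poly (p - q) x = 0}"
    by (intro poly_roots_finite) simp
  moreover have "of_nat ` {0::nat<..} \<subseteq> {x. poly (p - q) x = 0}"
    using assms by (auto simp: is_ehrhart_polynomial_def)
  ultimately have "finite ((of_nat :: nat \<Rightarrow> rat) ` {0::nat<..})"
    by (rule rev_finite_subset)
  then have "finite {0::nat<..}"
    by (rule finite_imageD) (simp add: inj_on_def)
  then show False
    by (simp add: infinite_Ioi)
qed

lemma ehrhart_polynomial_eqI: "is_ehrhart_polynomial P p \<Longrightarrow> ehrhart_polynomial P = p"
  unfolding ehrhart_polynomial_def
  by (blast intro: is_ehrhart_polynomial_unique the_equality)

end

theory Submission
  imports Defs
begin

text \<open>The base polytope of a snake matroid is an order polytope in disguise, and the order polynomials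
of fences (posets whose Hasse diagram is a zig-zag path with arbitrary up and down steps) have
nonnegative coefficients.

\<^bold>\<open>From snakes to fences.\<close> Let the lattice path matroid be bounded by paths with heights
\<open>p \<le> q\<close>. If the paths touch at an inner position, the matroid is a direct sum
(\<open>touching_paths_disconnected\<close>); if \<open>q k \<ge> p k + 2\<close> somewhere, the region contains a two by two
block of cells, whose six paths give a minor isomorphic to the uniform matroid of rank 2 on 4 elements (\<open>wide_paths_U24_minor\<close>). So for a snake
\<open>q k = p k + 1\<close> at every inner position. The partial sums \<open>S k\<close> of a lattice point of \<open>t P(M)\<close>
satisfy \<open>t p k \<le> S k \<le> t q k\<close> and grow by at most \<open>t\<close>; conversely such a sequence is the sum of
the \<open>t\<close> paths with heights \<open>\<lfloor>(S k + j) / t\<rfloor>\<close>, \<open>j < t\<close> (\<open>partial_sums_in_dilation\<close>). For a snake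
the numbers \<open>S k - t p k\<close> lie in \<open>{0..t}\<close>, and the condition on the growth of \<open>S\<close> turns into a weak
inequality between neighbours whose direction is read off from the steps of the lower path. Hence the
Ehrhart polynomial at \<open>t\<close> is \<open>\<Omega>(t + 1)\<close> for the order polynomial \<open>\<Omega>\<close> of a fence
(\<open>card_dilation_points_snake\<close>).

\<^bold>\<open>Positivity for fences.\<close> Cutting an order preserving map at height \<open>s\<close> gives
\<open>\<Omega>(V; s + t) = (\<Sum>I. \<Omega>(I; s) \<Omega>(V - I; t))\<close>, summed over the order ideals \<open>I\<close> of \<open>V\<close>. Differentiating
at \<open>s = 0\<close> expresses the derivative of \<open>\<Omega>(V; _)\<close> through order polynomials of smaller sets with the
linear coefficients of the \<open>\<Omega>(I; _)\<close> as weights. By induction it suffices that these linear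
coefficients are nonnegative (\<open>nonneg_order_polynomial\<close>). A disconnected subset of a fence has linear
coefficient 0, because its order polynomial is a product of two polynomials vanishing at 0. On an
interval, replace every descent \<open>x \<ge> y\<close> by the difference of \<open>no condition\<close> and \<open>x < y\<close>. Dropping a
condition disconnects the fence and so does not affect the linear coefficient; what is left is, up to the
sign \<open>(-1)\<^sup>d\<close>, a chain with \<open>d\<close> strict and \<open>w\<close> weak inequalities, counted by the binomial
coefficient of \<open>t + w\<close> over \<open>w + d + 1\<close>. Its linear coefficient is \<open>(-1)\<^sup>d w! d! / (w + d + 1)!\<close>, so
the signs cancel (\<open>fence_interval_polynomial\<close>).

\<^bold>\<open>Direct sums.\<close> The base polytope of a direct sum is the Minkowski sum of polytopes in complementary
coordinate subspaces, so Ehrhart polynomials multiply.\<close>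

section \<open>Order polynomials\<close>

text \<open>The relation is restricted to \<open>V\<close> implicitly, so that one relation serves for all subsets of a poset.\<close>

definition order_maps :: "('a \<times> 'a) set \<Rightarrow> 'a set \<Rightarrow> nat \<Rightarrow> ('a \<Rightarrow> nat) set" where
  "order_maps R V t =
     {f \<in> V \<rightarrow>\<^sub>E {..<t}. \<forall>u\<in>V. \<forall>v\<in>V. (u, v) \<in> R \<longrightarrow> f u \<le> f v}"

definition is_order_polynomial :: "('a \<times> 'a) set \<Rightarrow> 'a set \<Rightarrow> rat poly \<Rightarrow> bool" where
  "is_order_polynomial R V p \<longleftrightarrow> (\<forall>t. poly p (of_nat t) = of_nat (card (order_maps R V t)))"

definition nonneg_poly :: "rat poly \<Rightarrow> bool" where
  "nonneg_poly p \<longleftrightarrow> (\<forall>i. coeff p i \<ge> 0)"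

lemma nonneg_poly_mult: "nonneg_poly p \<Longrightarrow> nonneg_poly q \<Longrightarrow> nonneg_poly (p * q)"
  by (auto simp: nonneg_poly_def coeff_mult intro!: sum_nonneg)

lemma nonneg_poly_add: "nonneg_poly p \<Longrightarrow> nonneg_poly q \<Longrightarrow> nonneg_poly (p + q)"
  by (auto simp: nonneg_poly_def)

lemma nonneg_poly_sum: "(\<And>i. i \<in> A \<Longrightarrow> nonneg_poly (f i)) \<Longrightarrow> nonneg_poly (sum f A)"
  by (auto simp: nonneg_poly_def coeff_sum intro!: sum_nonneg)

lemma nonneg_poly_pCons: "nonneg_poly (pCons a p) \<longleftrightarrow> a \<ge> 0 \<and> nonneg_poly p"
proof
  assume h: "nonneg_poly (pCons a p)"
  have "coeff p i \<ge> 0" for i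
    using h[unfolded nonneg_poly_def, rule_format, of "Suc i"] by simp
  moreover have "a \<ge> 0" using h[unfolded nonneg_poly_def, rule_format, of 0] by simp
  ultimately show "a \<ge> 0 \<and> nonneg_poly p" by (simp add: nonneg_poly_def)
qed (auto simp: nonneg_poly_def coeff_pCons split: nat.split)

lemma nonneg_poly_0: "nonneg_poly 0" by (simp add: nonneg_poly_def)

lemma nonneg_poly_1: "nonneg_poly 1"
  using nonneg_poly_pCons[of 1 0] by (simp add: nonneg_poly_0 one_pCons)

lemma nonneg_poly_pcompose: "nonneg_poly p \<Longrightarrow> nonneg_poly q \<Longrightarrow> nonneg_poly (pcompose p q)"
  by (induction p)
     (auto simp: pcompose_pCons nonneg_poly_pCons nonneg_poly_0 intro!: nonneg_poly_add nonneg_poly_mult)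

lemma finite_order_maps: "finite V \<Longrightarrow> finite (order_maps R V t)"
  unfolding order_maps_def by (rule finite_subset[of _ "V \<rightarrow>\<^sub>E {..<t}"]) (auto intro: finite_PiE)

definition ideals :: "('a \<times> 'a) set \<Rightarrow> 'a set \<Rightarrow> 'a set set" where
  "ideals R V = {I. I \<subseteq> V \<and> (\<forall>u\<in>V. \<forall>v\<in>I. (u, v) \<in> R \<longrightarrow> u \<in> I)}"

lemma finite_ideals: "finite V \<Longrightarrow> finite (ideals R V)"
  unfolding ideals_def by (rule finite_subset[of _ "Pow V"]) auto

text \<open>A map into \<open>{..<s + t}\<close> is cut at height \<open>s\<close>: the elements with values below \<open>s\<close> form an order ideal,
and subtracting \<open>s\<close> on the complement leaves values below \<open>t\<close>. The two halves can be glued back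
because no element of an ideal lies above an element outside.\<close>

lemma card_order_maps_add:
  assumes fin: "finite V"
  shows "card (order_maps R V (s + t)) =
    (\<Sum>I\<in>ideals R V. card (order_maps R I s) * card (order_maps R (V - I) t))"
proof -
  let ?S = "SIGMA I:ideals R V. order_maps R I s \<times> order_maps R (V - I) t"
  let ?F = "\<lambda>f. let I = {v \<in> V. f v < s} in (I, restrict f I, restrict (\<lambda>v. f v - s) (V - I))"
  let ?G = "\<lambda>(I, g, h) v. if v \<in> I then g v else if v \<in> V then h v + s else undefined"
  have "bij_betw ?F (order_maps R V (s + t)) ?S"
  proof (rule bij_betw_byWitness[where f' = ?G])
    show "\<forall>f\<in>order_maps R V (s + t). ?G (?F f) = f"
      by (auto simp: order_maps_def Let_def fun_eq_iff PiE_def extensional_def)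
    have inv: "?F (?G (I, g, h)) = (I, g, h)"
      if "I \<in> ideals R V" "g \<in> order_maps R I s" "h \<in> order_maps R (V - I) t" for I g h
    proof -
      have "{v \<in> V. ?G (I, g, h) v < s} = I"
        using that by (auto simp: ideals_def order_maps_def)
      then show ?thesis
        using that by (auto simp: order_maps_def Let_def fun_eq_iff PiE_def extensional_def ideals_def)
    qed
    then show "\<forall>x\<in>?S. ?F (?G x) = x" by blast
    show "?F ` order_maps R V (s + t) \<subseteq> ?S"
    proof
      fix x assume "x \<in> ?F ` order_maps R V (s + t)"
      then obtain f where f: "f \<in> order_maps R V (s + t)" "x = ?F f" by blast
      then have m: "f u \<le> f v" if "u \<in> V" "v \<in> V" "(u, v) \<in> R" for u v
        using that by (auto simp: order_maps_def)
      have b: "f v - s < t" if "v \<in> V" "\<not> f v < s" for v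
        using f that by (fastforce simp: order_maps_def PiE_def Pi_def)
      show "x \<in> ?S"
        using f(2) m b
        by (fastforce simp: Let_def order_maps_def ideals_def intro!: diff_le_mono)
    qed
    show "?G ` ?S \<subseteq> order_maps R V (s + t)"
    proof (rule image_subsetI)
      fix x assume "x \<in> ?S"
      then obtain I g h where x: "x = (I, g, h)" and I: "I \<in> ideals R V"
        and g: "g \<in> order_maps R I s" and h: "h \<in> order_maps R (V - I) t" by blast
      have gs: "g u < s" if "u \<in> I" for u using that g by (auto simp: order_maps_def)
      have hs: "h u < t" if "u \<in> V" "u \<notin> I" for u using that h by (auto simp: order_maps_def)
      show "?G x \<in> order_maps R V (s + t)"
        unfolding order_maps_def x
      proof (intro CollectI conjI ballI impI)
        show "?G (I, g, h) \<in> V \<rightarrow>\<^sub>E {..<s + t}"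
          using I gs[THEN trans_less_add1] hs by (auto simp: ideals_def)
        fix u v assume uv: "u \<in> V" "v \<in> V" "(u, v) \<in> R"
        then show "?G (I, g, h) u \<le> ?G (I, g, h) v"
          using I g h gs[of u] by (auto simp: ideals_def order_maps_def)
      qed
    qed
  qed
  then have "card (order_maps R V (s + t)) = card ?S" by (rule bij_betw_same_card)
  also have "\<dots> = (\<Sum>I\<in>ideals R V. card (order_maps R I s \<times> order_maps R (V - I) t))"
    using fin by (intro card_SigmaI)
      (auto simp: finite_ideals ideals_def intro!: finite_cartesian_product finite_order_maps
        intro: finite_subset)
  finally show ?thesis by (simp add: card_cartesian_product)
qed

text \<open>A nonzero polynomial has finitely many roots, so it cannot vanish at all natural numbers.\<close>

lemma poly_eqI_nat:
  fixes p q :: "rat poly"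
  assumes "\<And>t::nat. poly p (of_nat t) = poly q (of_nat t)"
  shows "p = q"
proof (rule ccontr)
  assume "p \<noteq> q"
  then have "finite {x. poly (p - q) x = 0}" by (intro poly_roots_finite) simp
  moreover have "range (of_nat :: nat \<Rightarrow> rat) \<subseteq> {x. poly (p - q) x = 0}" using assms by auto
  ultimately have "finite (range (of_nat :: nat \<Rightarrow> rat))" by (rule rev_finite_subset)
  then show False using finite_imageD[of "of_nat :: nat \<Rightarrow> rat" UNIV] by (simp add: inj_on_def)
qed

lemma coeff_0_order_polynomial:
  assumes "is_order_polynomial R V p" "V \<noteq> {}"
  shows "coeff p 0 = 0"
proof -
  have "order_maps R V 0 = {}" using assms(2) by (auto simp: order_maps_def)
  then have "poly p (of_nat 0) = 0" using assms(1)[unfolded is_order_polynomial_def, rule_format, of 0] by simp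
  then show ?thesis by (simp add: poly_0_coeff_0)
qed

lemma order_maps_empty: "order_maps R {} t = {\<lambda>_. undefined}"
  by (auto simp: order_maps_def)

lemma is_order_polynomial_empty: "is_order_polynomial R {} 1"
  by (simp add: is_order_polynomial_def order_maps_empty)

text \<open>Comparing linear coefficients in the shift identity below amounts to differentiating it at 0.\<close>

lemma coeff_1_pcompose_shift: "coeff (pcompose p [:a, 1:]) 1 = poly (pderiv p) (a::rat)"
proof -
  have "coeff (pcompose p [:a, 1:]) 1 = coeff (pderiv (pcompose p [:a, 1:])) 0"
    by (simp add: coeff_pderiv)
  also have "pderiv (pcompose p [:a, 1:]) = pcompose (pderiv p) [:a, 1:]"
    by (simp add: pderiv_pcompose pderiv_pCons)
  also have "coeff \<dots> 0 = poly (pderiv p) a"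
    by (simp add: poly_pcompose flip: poly_0_coeff_0)
  finally show ?thesis .
qed

text \<open>The convolution \<open>\<Omega>(V; s + t) = (\<Sum>I. \<Omega>(I; s) \<Omega>(V - I; t))\<close> is an identity of polynomials in \<open>s\<close>
for each fixed \<open>t\<close>; its linear coefficients in \<open>s\<close> give the derivative at \<open>t\<close>.\<close>

lemma order_polynomial_pderiv:
  assumes fin: "finite V" and om: "\<And>I. I \<subseteq> V \<Longrightarrow> is_order_polynomial R I (om I)"
  shows "pderiv (om V) = (\<Sum>I\<in>ideals R V. smult (coeff (om I) 1) (om (V - I)))"
proof (rule poly_eqI_nat)
  fix t :: nat
  have I: "I \<subseteq> V" if "I \<in> ideals R V" for I using that by (simp add: ideals_def)
  \<comment> \<open>The convolution, as an identity of polynomials in the first argument.\<close>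
  have "pcompose (om V) [:of_nat t, 1:] = (\<Sum>I\<in>ideals R V. smult (poly (om (V - I)) (of_nat t)) (om I))"
  proof (rule poly_eqI_nat)
    fix s :: nat
    have "poly (pcompose (om V) [:of_nat t, 1:]) (of_nat s) = poly (om V) (of_nat (s + t))"
      by (simp add: poly_pcompose add.commute)
    also have "\<dots> = of_nat (card (order_maps R V (s + t)))"
      using om[of V] by (simp only: is_order_polynomial_def order_refl)
    also have "\<dots> = (\<Sum>I\<in>ideals R V. poly (om I) (of_nat s) * poly (om (V - I)) (of_nat t))"
      using om I by (simp add: card_order_maps_add[OF fin] is_order_polynomial_def)
    finally show "poly (pcompose (om V) [:of_nat t, 1:]) (of_nat s) =
        poly (\<Sum>I\<in>ideals R V. smult (poly (om (V - I)) (of_nat t)) (om I)) (of_nat s)"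
      by (simp add: poly_sum mult.commute)
  qed
  then have "poly (pderiv (om V)) (of_nat t) =
      coeff (\<Sum>I\<in>ideals R V. smult (poly (om (V - I)) (of_nat t)) (om I)) 1"
    by (metis coeff_1_pcompose_shift)
  then show "poly (pderiv (om V)) (of_nat t) =
      poly (\<Sum>I\<in>ideals R V. smult (coeff (om I) 1) (om (V - I))) (of_nat t)"
    by (simp add: coeff_sum poly_sum mult.commute)
qed

text \<open>Linear coefficients control all others. The ideal \<open>{}\<close> contributes nothing to the derivative, since
\<open>\<Omega>({}; _) = 1\<close> has linear coefficient 0; all other summands are nonnegative multiples of order
polynomials of proper subsets. So the derivative has nonnegative coefficients by induction, and the
constant term is 0 because there is no map from a nonempty set into \<open>{..<0}\<close>.\<close>

lemma nonneg_order_polynomial: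
  assumes fin: "finite V"
    and lin: "\<And>I. I \<subseteq> V \<Longrightarrow> I \<noteq> {} \<Longrightarrow> \<exists>p. is_order_polynomial R I p \<and> coeff p 1 \<ge> 0"
  shows "\<exists>p. is_order_polynomial R V p \<and> nonneg_poly p"
proof -
  have "\<exists>p. is_order_polynomial R I p \<and> coeff p 1 \<ge> 0" if "I \<subseteq> V" for I
    using lin[of I] that is_order_polynomial_empty[of R] by (cases "I = {}") force+
  then obtain om where om: "\<And>I. I \<subseteq> V \<Longrightarrow> is_order_polynomial R I (om I)"
    and l: "\<And>I. I \<subseteq> V \<Longrightarrow> coeff (om I) 1 \<ge> 0" by metis
  have "nonneg_poly (om W)" if "W \<subseteq> V" for W
    using finite_subset[OF that fin] that
  proof (induction W rule: finite_psubset_induct)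
    case (psubset W)
    show ?case
    proof (cases "W = {}")
      case True
      then have "om W = 1"
        using om[of "{}"] is_order_polynomial_empty[of R]
        by (intro poly_eqI_nat) (simp add: is_order_polynomial_def)
      then show ?thesis by (simp add: nonneg_poly_1)
    next
      case False
      have c0: "coeff (om I) 0 = 0" if "I \<subseteq> W" "I \<noteq> {}" for I
        using om[of I] psubset.prems that coeff_0_order_polynomial by blast
      have "pderiv (om W) = (\<Sum>I\<in>ideals R W. smult (coeff (om I) 1) (om (W - I)))"
        using psubset.prems by (intro order_polynomial_pderiv psubset.hyps om) auto
      moreover have "nonneg_poly \<dots>"
      proof (rule nonneg_poly_sum)
        fix I assume "I \<in> ideals R W"
        then have I: "I \<subseteq> W" by (simp add: ideals_def)
        show "nonneg_poly (smult (coeff (om I) 1) (om (W - I)))"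
        proof (cases "I = {}")
          case True
          have "om {} = 1"
            using om[of "{}"] is_order_polynomial_empty[of R]
            by (intro poly_eqI_nat) (simp add: is_order_polynomial_def)
          then show ?thesis using True by (simp add: nonneg_poly_0)
        next
          case False
          then have "W - I \<subset> W" using I by blast
          then have "nonneg_poly (om (W - I))" using psubset by blast
          moreover have "coeff (om I) 1 \<ge> 0" using l I psubset.prems by blast
          ultimately show ?thesis by (simp add: nonneg_poly_def)
        qed
      qed
      ultimately have "nonneg_poly (pderiv (om W))" by simp
      then have "coeff (om W) (Suc i) \<ge> 0" for i
        by (auto simp: nonneg_poly_def coeff_pderiv zero_le_mult_iff dest!: spec[of _ i])
      then have "coeff (om W) i \<ge> 0" for i
        using c0[of W] False by (cases i) auto
      then show ?thesis by (simp add: nonneg_poly_def)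
    qed
  qed
  then show ?thesis using om by blast
qed

section \<open>Fences\<close>

text \<open>Arbitrary conditions between neighbouring positions are allowed, because the proof also needs strict
inequalities and omitted conditions. Only neighbours that both lie in \<open>V\<close> are compared.\<close>

definition fillings :: "(nat \<Rightarrow> nat \<Rightarrow> nat \<Rightarrow> bool) \<Rightarrow> nat set \<Rightarrow> nat \<Rightarrow> (nat \<Rightarrow> nat) set" where
  "fillings c V t =
     {f \<in> V \<rightarrow>\<^sub>E {..<t}. \<forall>i. i \<in> V \<and> Suc i \<in> V \<longrightarrow> c i (f i) (f (Suc i))}"

lemma finite_fillings: "finite V \<Longrightarrow> finite (fillings c V t)"
  unfolding fillings_def by (rule finite_subset[of _ "V \<rightarrow>\<^sub>E {..<t}"]) (auto intro: finite_PiE)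

text \<open>Without a condition between \<open>m\<close> and its successor, the two sides can be filled independently.\<close>

lemma card_fillings_cut:
  assumes free: "m \<in> V \<Longrightarrow> Suc m \<in> V \<Longrightarrow> c m = (\<lambda>_ _. True)"
  shows "card (fillings c V t) =
    card (fillings c (V \<inter> {..m}) t) * card (fillings c (V \<inter> {m<..}) t)"
proof -
  let ?A = "V \<inter> {..m}" and ?B = "V \<inter> {m<..}"
  let ?F = "\<lambda>f. (restrict f ?A, restrict f ?B)"
  let ?G = "\<lambda>(g, h) v. if v \<le> m then g v else (h v :: nat)"
  have "bij_betw ?F (fillings c V t) (fillings c ?A t \<times> fillings c ?B t)"
  proof (rule bij_betw_byWitness[where f' = ?G])
    have "?G (?F f) = f" if "f \<in> fillings c V t" for f
      using that by (simp add: fillings_def fun_eq_iff PiE_def extensional_def)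
    then show "\<forall>f\<in>fillings c V t. ?G (?F f) = f" by blast
    have "?F (?G (g, h)) = (g, h)" if "g \<in> fillings c ?A t" "h \<in> fillings c ?B t" for g h
      using that by (auto simp: fillings_def fun_eq_iff PiE_def extensional_def)
    then show "\<forall>x\<in>fillings c ?A t \<times> fillings c ?B t. ?F (?G x) = x" by blast
    have "restrict f W \<in> fillings c W t" if "f \<in> fillings c V t" "W \<subseteq> V" for f W
      using that unfolding fillings_def PiE_def Pi_def by (simp add: subset_iff)
    then show "?F ` fillings c V t \<subseteq> fillings c ?A t \<times> fillings c ?B t" by blast
    show "?G ` (fillings c ?A t \<times> fillings c ?B t) \<subseteq> fillings c V t"
    proof (rule image_subsetI)
      fix x assume "x \<in> fillings c ?A t \<times> fillings c ?B t"
      then obtain g h where x: "x = (g, h)" and g: "g \<in> fillings c ?A t"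
        and h: "h \<in> fillings c ?B t" by blast
      show "?G x \<in> fillings c V t"
        unfolding fillings_def x
      proof (intro CollectI conjI allI impI)
        show "?G (g, h) \<in> V \<rightarrow>\<^sub>E {..<t}"
          using g h by (fastforce simp: fillings_def PiE_def Pi_def extensional_def)
        fix i assume i: "i \<in> V \<and> Suc i \<in> V"
        consider "i < m" | "i = m" | "i > m" by linarith
        then show "c i (?G (g, h) i) (?G (g, h) (Suc i))"
          using g h i free by cases (auto simp: fillings_def)
      qed
    qed
  qed
  from bij_betw_same_card[OF this] show ?thesis by (simp add: card_cartesian_product)
qed

lemma fillings_cong:
  "(\<And>i. i \<in> V \<Longrightarrow> Suc i \<in> V \<Longrightarrow> c i = c' i) \<Longrightarrow> fillings c V t = fillings c' V t"
  by (auto simp: fillings_def)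

text \<open>A fence has \<open>S = {}\<close>; strict ascents enter when a weak descent is replaced by its complement.\<close>

definition fence_constraint :: "nat set \<Rightarrow> nat set \<Rightarrow> nat \<Rightarrow> nat \<Rightarrow> nat \<Rightarrow> bool" where
  "fence_constraint G S i x y = (if i \<in> G then y \<le> x else if i \<in> S then x < y else x \<le> y)"

text \<open>The fillings without a condition at \<open>m\<close> split into those with a weak descent and those with a strict
ascent there. This trades a descent for an ascent, at the price of a sign and of a product.\<close>

lemma card_fillings_descent:
  assumes "finite V" "m \<in> V" "Suc m \<in> V" "m \<in> G"
  shows "card (fillings (fence_constraint G S) (V \<inter> {..m}) t) *
         card (fillings (fence_constraint G S) (V \<inter> {m<..}) t) =
    card (fillings (fence_constraint G S) V t) +
    card (fillings (fence_constraint (G - {m}) (insert m S)) V t)"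
proof -
  let ?c = "(fence_constraint G S)(m := \<lambda>_ _. True)"
  let ?P = "\<lambda>f. \<forall>i. i \<noteq> m \<and> i \<in> V \<and> Suc i \<in> V \<longrightarrow> fence_constraint G S i (f i) (f (Suc i))"
  have key: "(\<forall>i. i \<in> V \<and> Suc i \<in> V \<longrightarrow> C i) \<longleftrightarrow>
      (\<forall>i. i \<noteq> m \<and> i \<in> V \<and> Suc i \<in> V \<longrightarrow> C i) \<and> C m"
      (is "?L \<longleftrightarrow> ?R \<and> _") for C
  proof
    assume ?L
    then show "?R \<and> C m" using assms(2,3) by simp
  next
    assume R: "?R \<and> C m"
    show ?L
    proof (intro allI impI)
      fix i assume "i \<in> V \<and> Suc i \<in> V"
      then show "C i" using R by (cases "i = m") simp_all
    qed
  qed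
  have "fillings ?c V t = {f \<in> V \<rightarrow>\<^sub>E {..<t}. ?P f}"
    unfolding fillings_def key by simp
  moreover have "fillings (fence_constraint G S) V t =
      {f \<in> V \<rightarrow>\<^sub>E {..<t}. ?P f \<and> f (Suc m) \<le> f m}"
    using assms(4) unfolding fillings_def key by (simp add: fence_constraint_def)
  moreover have "fillings (fence_constraint (G - {m}) (insert m S)) V t =
      {f \<in> V \<rightarrow>\<^sub>E {..<t}. ?P f \<and> f m < f (Suc m)}"
    unfolding fillings_def key by (simp add: fence_constraint_def)
  ultimately have "fillings ?c V t = fillings (fence_constraint G S) V t \<union>
      fillings (fence_constraint (G - {m}) (insert m S)) V t"
    and "fillings (fence_constraint G S) V t \<inter>
      fillings (fence_constraint (G - {m}) (insert m S)) V t = {}"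
    by (auto simp: not_le)
  then have "card (fillings ?c V t) = card (fillings (fence_constraint G S) V t) +
      card (fillings (fence_constraint (G - {m}) (insert m S)) V t)"
    using assms(1) by (simp add: card_Un_disjoint finite_fillings)
  moreover have "card (fillings ?c V t) =
      card (fillings ?c (V \<inter> {..m}) t) * card (fillings ?c (V \<inter> {m<..}) t)"
    by (rule card_fillings_cut) simp
  moreover have "fillings ?c (V \<inter> {..m}) t = fillings (fence_constraint G S) (V \<inter> {..m}) t"
    by (rule fillings_cong) auto
  moreover have "fillings ?c (V \<inter> {m<..}) t = fillings (fence_constraint G S) (V \<inter> {m<..}) t"
    by (rule fillings_cong) auto
  ultimately show ?thesis by simp
qed

lemma sum_choose_shift:
  "a \<le> n \<Longrightarrow> (\<Sum>v<t. (v + a) choose n) = (t + a) choose Suc n"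
  by (induction t) (auto simp: binomial_eq_0)

text \<open>Adding the index of weak steps passed so far makes a chain strictly increasing, hence a subset of
\<open>{..<t + w}\<close> with \<open>w\<close> the number of weak steps. The proof sums over the last value instead, where
the binomial coefficients add up by the hockey stick identity.\<close>

lemma card_fillings_chain:
  assumes "a \<le> b"
  shows "card (fillings (fence_constraint {} S) {a..b} t) =
    (t + card ({a..<b} - S)) choose Suc (b - a)"
  using assms
proof (induction b arbitrary: t rule: dec_induct)
  case base
  have "fillings (fence_constraint {} S) {a..a} t = {a} \<rightarrow>\<^sub>E {..<t}"
    by (simp add: fillings_def)
  then show ?case by (simp add: card_PiE)
next
  case (step b)
  let ?c = "fence_constraint {} S"
  let ?w = "card ({a..<b} - S)"
  \<comment> \<open>The values before the last value \<open>v\<close> lie below \<open>?e v\<close>.\<close>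
  let ?e = "\<lambda>v. if b \<in> S then v else Suc v"
  let ?T = "SIGMA v:{..<t}. fillings ?c {a..b} (?e v)"
  let ?F = "\<lambda>f. (f (Suc b), restrict f {a..b})"
  let ?G = "\<lambda>(x, g) v. if v = Suc b then x else (g v :: nat)"
  have mono: "f i \<le> f b" if "f \<in> fillings ?c {a..Suc b} t" "i \<in> {a..b}" for f i
  proof -
    have "i \<le> b" using that by simp
    then show ?thesis
      using \<open>i \<in> {a..b}\<close>
    proof (induction i rule: inc_induct)
      case (step i)
      have "?c i (f i) (f (Suc i))" using that(1) step by (auto simp: fillings_def)
      then have "f i \<le> f (Suc i)" by (auto simp: fence_constraint_def split: if_splits)
      also have "\<dots> \<le> f b" using step by simp
      finally show ?case .
    qed simp
  qed
  have "bij_betw ?F (fillings ?c {a..Suc b} t) ?T"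
  proof (rule bij_betw_byWitness[where f' = ?G])
    show "\<forall>f\<in>fillings ?c {a..Suc b} t. ?G (?F f) = f"
      using step.hyps by (auto simp: fillings_def fun_eq_iff PiE_def extensional_def)
    show "\<forall>x\<in>?T. ?F (?G x) = x"
      using step.hyps by (auto simp: fillings_def fun_eq_iff PiE_def extensional_def)
    show "?F ` fillings ?c {a..Suc b} t \<subseteq> ?T"
    proof
      fix x assume "x \<in> ?F ` fillings ?c {a..Suc b} t"
      then obtain f where f: "f \<in> fillings ?c {a..Suc b} t" "x = ?F f" by blast
      have "?c b (f b) (f (Suc b))" using f(1) step.hyps by (auto simp: fillings_def)
      then have "f b < ?e (f (Suc b))" by (auto simp: fence_constraint_def split: if_splits)
      then have lt: "f i < ?e (f (Suc b))" if "i \<in> {a..b}" for i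
        using mono[OF f(1) that] by linarith
      have "f (Suc b) < t" using f(1) step.hyps by (auto simp: fillings_def)
      moreover have "restrict f {a..b} \<in> fillings ?c {a..b} (?e (f (Suc b)))"
        unfolding fillings_def using f(1) lt by (auto simp: fillings_def)
      ultimately show "x \<in> ?T" using f(2) by simp
    qed
    show "?G ` ?T \<subseteq> fillings ?c {a..Suc b} t"
    proof (rule image_subsetI)
      fix y assume "y \<in> ?T"
      then obtain x g where y: "y = (x, g)" and x: "x < t" and g: "g \<in> fillings ?c {a..b} (?e x)"
        by blast
      have lt: "g i < ?e x" if "i \<in> {a..b}" for i using g that by (auto simp: fillings_def)
      show "?G y \<in> fillings ?c {a..Suc b} t"
        unfolding fillings_def y
      proof (intro CollectI conjI allI impI)
        have "g i < t" if "i \<in> {a..b}" for i using lt[OF that] x by (auto split: if_splits)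
        then show "?G (x, g) \<in> {a..Suc b} \<rightarrow>\<^sub>E {..<t}"
          using x g \<open>a \<le> b\<close> by (auto simp: fillings_def PiE_def extensional_def Pi_def)
        fix i assume i: "i \<in> {a..Suc b} \<and> Suc i \<in> {a..Suc b}"
        show "?c i (?G (x, g) i) (?G (x, g) (Suc i))"
        proof (cases "i = b")
          case True
          then show ?thesis using lt[of b] step.hyps
            by (auto simp: fence_constraint_def split: if_splits)
        next
          case False
          then show ?thesis using i g by (auto simp: fillings_def)
        qed
      qed
    qed
  qed
  then have "card (fillings ?c {a..Suc b} t) = card ?T" by (rule bij_betw_same_card)
  also have "\<dots> = (\<Sum>v<t. card (fillings ?c {a..b} (?e v)))"
    by (simp add: card_SigmaI finite_fillings)
  also have "\<dots> = (\<Sum>v<t. (?e v + ?w) choose Suc (b - a))"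
    using step.IH by simp
  also have "\<dots> = (\<Sum>v<t. (v + card ({a..<Suc b} - S)) choose Suc (b - a))"
  proof (rule sum.cong[OF refl])
    fix v
    have *: "{a..<Suc b} - S = (if b \<in> S then {a..<b} - S else insert b ({a..<b} - S))"
      using step.hyps by (auto simp: less_Suc_eq)
    have "card ({a..<Suc b} - S) = ?w + (if b \<in> S then 0 else 1)"
      unfolding * by simp
    then show "(?e v + ?w) choose Suc (b - a) = (v + card ({a..<Suc b} - S)) choose Suc (b - a)"
      by simp
  qed
  also have "\<dots> = (t + card ({a..<Suc b} - S)) choose Suc (Suc (b - a))"
  proof (rule sum_choose_shift)
    have "card ({a..<Suc b} - S) \<le> card {a..<Suc b}" by (rule card_mono) auto
    then show "card ({a..<Suc b} - S) \<le> Suc (b - a)" by simp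
  qed
  finally show ?case using step.hyps by (simp add: Suc_diff_le)
qed

text \<open>The binomial coefficient is the product of the factors \<open>t + w - i\<close>, \<open>i < n\<close>, up to a factorial. The factor
with \<open>i = w\<close> is \<open>t\<close>, and the constant terms of the others have \<open>d\<close> negative signs, for \<open>i > w\<close>.\<close>

lemma shifted_choose_polynomial:
  assumes "n = Suc (w + d)"
  shows "\<exists>p :: rat poly. (\<forall>t::nat. poly p (of_nat t) = of_nat ((t + w) choose n)) \<and>
    coeff p 0 = 0 \<and> (- 1) ^ d * coeff p 1 \<ge> 0"
proof -
  let ?f = "\<lambda>i. [:rat_of_nat w - of_nat i, 1:]"
  define q where "q = prod ?f ({..<n} - {w})"
  define p where "p = smult (1 / fact n) (pCons 0 q)"
  have w: "w < n" using assms by simp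
  have pq: "pCons 0 q = prod ?f {..<n}"
    using w by (simp add: q_def prod.remove[of "{..<n}" w])
  have v: "poly p (of_nat t) = of_nat ((t + w) choose n)" for t :: nat
  proof -
    have "rat_of_nat ((t + w) choose n) = (of_nat (t + w)) gchoose n"
      by (simp add: binomial_gbinomial)
    also have "\<dots> = (\<Prod>i<n. rat_of_nat (t + w) - of_nat i) / fact n"
      by (simp add: gbinomial_prod_rev atLeast0LessThan)
    also have "\<dots> = poly p (of_nat t)"
      by (simp add: p_def pq poly_prod algebra_simps)
    finally show ?thesis ..
  qed
  have split: "{..<n} - {w} = {..<w} \<union> {w<..<n}" using w by auto
  have "coeff p 1 = poly q 0 / fact n"
    by (simp add: p_def poly_0_coeff_0)
  also have "poly q 0 = (\<Prod>i\<in>{..<n} - {w}. rat_of_nat w - of_nat i)"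
    by (simp add: q_def poly_prod)
  also have "\<dots> = (\<Prod>i<w. rat_of_nat w - of_nat i) * (\<Prod>i\<in>{w<..<n}. rat_of_nat w - of_nat i)"
    unfolding split by (rule prod.union_disjoint) auto
  also have "(\<Prod>i\<in>{w<..<n}. rat_of_nat w - of_nat i) =
      (\<Prod>i\<in>{w<..<n}. (- 1) * (rat_of_nat i - of_nat w))"
    by (rule prod.cong) auto
  also have "\<dots> = (- 1) ^ d * (\<Prod>i\<in>{w<..<n}. rat_of_nat i - of_nat w)"
    unfolding prod.distrib using assms by simp
  finally have "(- 1) ^ d * coeff p 1 = ((- 1) ^ d * (- 1) ^ d) *
      ((\<Prod>i<w. rat_of_nat w - of_nat i) * (\<Prod>i\<in>{w<..<n}. rat_of_nat i - of_nat w)) / fact n"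
    by simp
  also have "(- 1) ^ d * (- 1) ^ d = (1 :: rat)"
    by (simp flip: power_mult_distrib)
  finally have "(- 1) ^ d * coeff p 1 \<ge> 0"
    by (auto intro!: divide_nonneg_pos mult_nonneg_nonneg prod_nonneg)
  moreover have "coeff p 0 = 0" by (simp add: p_def)
  ultimately show ?thesis using v by blast
qed

text \<open>Descents are eliminated one at a time with \<open>card_fillings_descent\<close>. The product of the two sides has linear
coefficient 0, since both factors vanish at 0. So each elimination negates the linear coefficient and
raises the number of strict ascents by one, and the sign \<open>(-1) ^ d\<close> in the statement absorbs this.\<close>

lemma fence_interval_polynomial:
  assumes "a \<le> b" "G \<inter> S = {}"
  shows "\<exists>p :: rat poly.
    (\<forall>t::nat. poly p (of_nat t) = of_nat (card (fillings (fence_constraint G S) {a..b} t))) \<and>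
    coeff p 0 = 0 \<and> (- 1) ^ card ({a..<b} \<inter> S) * coeff p 1 \<ge> 0"
  using assms
proof (induction "card ({a..<b} \<inter> G)" arbitrary: a b G S rule: less_induct)
  case less
  show ?case
  proof (cases "{a..<b} \<inter> G = {}")
    case True
    have "fillings (fence_constraint G S) {a..b} t = fillings (fence_constraint {} S) {a..b} t" for t
      using True by (intro fillings_cong) (force simp: fence_constraint_def fun_eq_iff)
    moreover have "Suc (b - a) = Suc (card ({a..<b} - S) + card ({a..<b} \<inter> S))"
    proof -
      have "card {a..<b} = card ({a..<b} - S) + card ({a..<b} \<inter> S)"
        by (metis card_Int_Diff add.commute finite_atLeastLessThan)
      then show ?thesis by simp
    qed
    from shifted_choose_polynomial[OF this] show ?thesis
      unfolding \<open>\<And>t. fillings (fence_constraint G S) {a..b} t = _ t\<close>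
        card_fillings_chain[OF \<open>a \<le> b\<close>] .
  next
    case False
    then obtain m where m: "m \<in> {a..<b}" "m \<in> G" by blast
    have sub: "card ({a..<m} \<inter> G) < card ({a..<b} \<inter> G)"
      "card ({Suc m..<b} \<inter> G) < card ({a..<b} \<inter> G)"
      "card ({a..<b} \<inter> (G - {m})) < card ({a..<b} \<inter> G)"
    proof -
      have "card X < card ({a..<b} \<inter> G)" if "X \<subseteq> {a..<b} \<inter> G" "m \<notin> X" for X
        using that m by (intro psubset_card_mono) blast+
      then show "card ({a..<m} \<inter> G) < card ({a..<b} \<inter> G)"
        "card ({Suc m..<b} \<inter> G) < card ({a..<b} \<inter> G)"
        "card ({a..<b} \<inter> (G - {m})) < card ({a..<b} \<inter> G)"
        using m(1) by (simp_all add: subset_iff)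
    qed
    obtain p1 :: "rat poly" where p1: "coeff p1 0 = 0"
      "\<And>t::nat. poly p1 (of_nat t) = of_nat (card (fillings (fence_constraint G S) {a..m} t))"
      using less.hyps[OF sub(1) _ less.prems(2)] m by auto
    obtain p2 :: "rat poly" where p2: "coeff p2 0 = 0"
      "\<And>t::nat. poly p2 (of_nat t) = of_nat (card (fillings (fence_constraint G S) {Suc m..b} t))"
      using less.hyps[OF sub(2) _ less.prems(2)] m by auto
    have "(G - {m}) \<inter> insert m S = {}" using less.prems by auto
    from less.hyps[OF sub(3) less.prems(1) this]
    obtain p3 :: "rat poly" where p3: "coeff p3 0 = 0"
      "(- 1) ^ card ({a..<b} \<inter> insert m S) * coeff p3 1 \<ge> 0"
      "\<And>t::nat. poly p3 (of_nat t) =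
        of_nat (card (fillings (fence_constraint (G - {m}) (insert m S)) {a..b} t))"
      by auto
    have "m \<notin> S" using m less.prems by auto
    have "{a..<b} \<inter> insert m S = insert m ({a..<b} \<inter> S)" using m by auto
    then have "card ({a..<b} \<inter> insert m S) = Suc (card ({a..<b} \<inter> S))"
      using \<open>m \<notin> S\<close> by simp
    then have sgn: "(- 1) ^ card ({a..<b} \<inter> S) * coeff p3 1 \<le> 0"
      using p3(2) by simp
    have iv: "{a..b} \<inter> {..m} = {a..m}" "{a..b} \<inter> {m<..} = {Suc m..b}" using m by auto
    let ?p = "p1 * p2 - p3"
    have "poly ?p (of_nat t) = of_nat (card (fillings (fence_constraint G S) {a..b} t))" for t :: nat
    proof -
      have "card (fillings (fence_constraint G S) {a..m} t) *
          card (fillings (fence_constraint G S) {Suc m..b} t) =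
          card (fillings (fence_constraint G S) {a..b} t) +
          card (fillings (fence_constraint (G - {m}) (insert m S)) {a..b} t)"
        using card_fillings_descent[of "{a..b}" m G S t] m unfolding iv by simp
      from arg_cong[OF this, of rat_of_nat] show ?thesis
        by (simp add: p1 p2 p3)
    qed
    moreover have "coeff ?p 0 = 0" using p1 p2 p3 by (simp add: coeff_mult)
    moreover have "coeff ?p 1 = - coeff p3 1" using p1 p2 by (simp add: coeff_mult)
    ultimately show ?thesis using sgn by (intro exI[of _ ?p]) simp
  qed
qed

definition fence :: "nat set \<Rightarrow> (nat \<times> nat) set" where
  "fence G = {(i, Suc i) | i. i \<notin> G} \<union> {(Suc i, i) | i. i \<in> G}"

lemma order_maps_fence: "order_maps (fence G) V t = fillings (fence_constraint G {}) V t"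
proof -
  have "(\<forall>u\<in>V. \<forall>v\<in>V. (u, v) \<in> fence G \<longrightarrow> f u \<le> f v) \<longleftrightarrow>
      (\<forall>i. i \<in> V \<and> Suc i \<in> V \<longrightarrow> fence_constraint G {} i (f i) (f (Suc i)))" for f
    unfolding fence_def fence_constraint_def by auto
  then show ?thesis unfolding order_maps_def fillings_def by simp
qed

text \<open>A subset with a gap is a disjoint union of two smaller fences without relations between them, so its order
polynomial is a product of two polynomials vanishing at 0. Subsets without a gap are intervals.\<close>

lemma fence_linear_coeff:
  assumes "finite V" "V \<noteq> {}"
  shows "\<exists>p. is_order_polynomial (fence G) V p \<and> coeff p 1 \<ge> 0"
  using assms
proof (induction V rule: finite_psubset_induct)
  case (psubset V)
  show ?case
  proof (cases "V = {Min V..Max V}")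
    case True
    have "Min V \<le> Max V" using psubset by simp
    from fence_interval_polynomial[OF this, of G "{}"] show ?thesis
      unfolding is_order_polynomial_def order_maps_fence True[symmetric] by auto
  next
    case False
    have mm: "V \<subseteq> {Min V..Max V}" "Min V \<in> V" "Max V \<in> V" using psubset by auto
    then obtain m where "m \<notin> V" "Min V \<le> m" "m \<le> Max V"
      using False by (metis atLeastAtMost_iff subsetI subset_antisym)
    then have m: "m \<notin> V" "Min V < m" "m < Max V"
      using mm by (metis le_neq_implies_less)+
    let ?A = "V \<inter> {..m}" and ?B = "V \<inter> {m<..}"
    have "Min V \<in> V" "Max V \<in> V" using psubset by auto
    then have "Min V \<in> ?A" "Max V \<in> ?B" "Min V \<notin> ?B" "Max V \<notin> ?A"
      using m(2,3) unfolding Int_iff atMost_iff greaterThan_iff by linarith+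
    then have AB: "?A \<subset> V" "?B \<subset> V" "?A \<noteq> {}" "?B \<noteq> {}" by blast+
    obtain p q where p: "is_order_polynomial (fence G) ?A p"
      and q: "is_order_polynomial (fence G) ?B q"
      using psubset.IH AB by meson
    have "is_order_polynomial (fence G) V (p * q)"
      using p q card_fillings_cut[of m V] m(1)
      by (simp add: is_order_polynomial_def order_maps_fence)
    moreover have "coeff (p * q) 1 = 0"
      using coeff_0_order_polynomial[OF p AB(3)] coeff_0_order_polynomial[OF q AB(4)]
      by (simp add: coeff_mult)
    ultimately show ?thesis by (intro exI[of _ "p * q"]) simp
  qed
qed

lemma fence_order_polynomial_nonneg:
  assumes "finite V"
  shows "\<exists>p. is_order_polynomial (fence G) V p \<and> nonneg_poly p"
  using assms
  by (intro nonneg_order_polynomial fence_linear_coeff) (auto intro: finite_subset)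

section \<open>Matroid exchange, minors and separators\<close>

lemma matroidD:
  assumes "matroid M"
  shows "finite (ground M)" "bases M \<noteq> {}" "\<And>B. B \<in> bases M \<Longrightarrow> B \<subseteq> ground M"
    "\<And>B. B \<in> bases M \<Longrightarrow> finite B"
    "\<And>A B x. A \<in> bases M \<Longrightarrow> B \<in> bases M \<Longrightarrow> x \<in> A \<Longrightarrow> x \<notin> B \<Longrightarrow>
      \<exists>y\<in>B - A. insert y (A - {x}) \<in> bases M"
proof -
  show fin: "finite (ground M)" and "bases M \<noteq> {}" using assms by (simp_all add: matroid_def)
  show sub: "B \<subseteq> ground M" if "B \<in> bases M" for B using assms that by (simp add: matroid_def)
  show "finite B" if "B \<in> bases M" for B using finite_subset[OF sub[OF that] fin] .
  show "\<exists>y\<in>B - A. insert y (A - {x}) \<in> bases M"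
    if "A \<in> bases M" "B \<in> bases M" "x \<in> A" "x \<notin> B" for A B x
    using assms that by (simp add: matroid_def)
qed

lemma card_less_of_subset:
  assumes "finite T" "S \<subseteq> T" "x \<in> T" "x \<notin> S"
  shows "card S < card T"
  using assms by (intro psubset_card_mono) auto

lemma card_bases_eq:
  assumes M: "matroid M" and "A \<in> bases M" "B \<in> bases M"
  shows "card A = card B"
  using assms(2)
proof (induction "card (A - B)" arbitrary: A rule: less_induct)
  case less
  show ?case
  proof (cases "A - B = {}")
    case True
    \<comment> \<open>An element of \<open>B - A\<close> could only be exchanged for an element of the empty set \<open>A - B\<close>.\<close>
    then have "B - A = {}" using matroidD(5)[OF M assms(3) less.prems] by blast
    then show ?thesis using True by (metis Diff_eq_empty_iff subset_antisym)
  next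
    case False
    then obtain x where x: "x \<in> A" "x \<notin> B" by blast
    then obtain y where y: "y \<in> B - A" "insert y (A - {x}) \<in> bases M"
      using matroidD(5)[OF M less.prems assms(3)] by blast
    have fin: "finite A" using matroidD(4)[OF M less.prems] .
    have "card (insert y (A - {x}) - B) < card (A - B)"
      using fin x y by (intro card_less_of_subset[where x = x]) auto
    from less.hyps[OF this y(2)] have "card (insert y (A - {x})) = card B" .
    moreover have "card (insert y (A - {x})) = card A"
      using x y fin card_Suc_Diff1[of A x] by simp
    ultimately show ?thesis by simp
  qed
qed

lemma basis_eqI:
  assumes "matroid M" "A \<in> bases M" "B \<in> bases M" "A \<subseteq> B"
  shows "A = B"
  using assms card_bases_eq card_subset_eq matroidD(4) by metis

text \<open>Among the bases containing \<open>I\<close>, exchange elements outside \<open>I \<union> B\<close> for elements of \<open>B\<close> as long as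
there are any.\<close>

lemma indep_extends_within:
  assumes M: "matroid M" and I: "indep M I" and B: "B \<in> bases M"
  obtains C where "C \<in> bases M" "I \<subseteq> C" "C \<subseteq> I \<union> B"
proof -
  have "\<exists>C\<in>bases M. I \<subseteq> C \<and> C \<subseteq> I \<union> B" if "D \<in> bases M" "I \<subseteq> D" for D
    using that
  proof (induction "card (D - (I \<union> B))" arbitrary: D rule: less_induct)
    case less
    show ?case
    proof (cases "D - (I \<union> B) = {}")
      case True
      then show ?thesis using less.prems by blast
    next
      case False
      then obtain x where x: "x \<in> D" "x \<notin> I" "x \<notin> B" by blast
      obtain y where y: "y \<in> B - D" "insert y (D - {x}) \<in> bases M"
        using matroidD(5)[OF M less.prems(1) B x(1,3)] by blast
      have "card (insert y (D - {x}) - (I \<union> B)) < card (D - (I \<union> B))"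
        using matroidD(4)[OF M less.prems(1)] x y
        by (intro card_less_of_subset[where x = x]) auto
      moreover have "I \<subseteq> insert y (D - {x})" using x less.prems by blast
      ultimately show ?thesis using less.hyps y(2) by blast
    qed
  qed
  then show ?thesis using I that unfolding indep_def by blast
qed

text \<open>Here the element that comes in is given and the one that goes out is found, which is the exchange axiom of the
dual matroid. Extending \<open>insert y (A \<inter> B)\<close> within \<open>A\<close> gives a basis inside \<open>insert y A\<close>, and by
cardinality it misses exactly one element.\<close>

lemma dual_exchange:
  assumes M: "matroid M" and A: "A \<in> bases M" and B: "B \<in> bases M" and y: "y \<in> B" "y \<notin> A"
  shows "\<exists>x\<in>A - B. insert y (A - {x}) \<in> bases M"
proof -
  have "indep M (insert y (A \<inter> B))" unfolding indep_def using B y by blast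
  then obtain C where C: "C \<in> bases M" "insert y (A \<inter> B) \<subseteq> C" "C \<subseteq> insert y (A \<inter> B) \<union> A"
    using indep_extends_within[OF M _ A] by metis
  have fin: "finite A" "finite C" using matroidD(4)[OF M] A C by auto
  have "\<not> A \<subseteq> C" using basis_eqI[OF M A C(1)] C(2) y by blast
  then obtain x where x: "x \<in> A" "x \<notin> C" by blast
  have "C \<subseteq> insert y (A - {x})" using C x by blast
  moreover have "card (insert y (A - {x})) = card C"
    using x y fin card_Suc_Diff1[of A x] card_bases_eq[OF M A C(1)] by simp
  ultimately have "C = insert y (A - {x})" using fin by (intro card_subset_eq) auto
  then show ?thesis using x C by blast
qed

lemma matroid_dual:
  assumes M: "matroid M"
  shows "matroid (dual M)"
  unfolding matroid_def dual_def
proof (simp, intro conjI ballI)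
  show "finite (ground M)" "bases M \<noteq> {}" using matroidD[OF M] by auto
  fix A B x assume AB: "A \<in> bases M" "B \<in> bases M" and "x \<in> ground M - A - (ground M - B)"
  then have x: "x \<in> B" "x \<notin> A" "x \<in> ground M" by auto
  obtain z where z: "z \<in> A - B" "insert x (A - {z}) \<in> bases M"
    using dual_exchange[OF M AB x(1,2)] by blast
  have "z \<in> ground M - B - (ground M - A)" using z matroidD(3)[OF M AB(1)] by blast
  moreover have "insert z (ground M - A - {x}) = ground M - insert x (A - {z})"
    using z x matroidD(3)[OF M AB(1)] by blast
  ultimately show "\<exists>y\<in>ground M - B - (ground M - A).
      insert y (ground M - A - {x}) \<in> (-) (ground M) ` bases M"
    using z(2) by blast
qed

text \<open>As soon as one basis avoids \<open>X\<close>, every independent set avoiding \<open>X\<close> extends to a basis avoiding \<open>X\<close>,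
so the maximal ones are bases.\<close>

lemma delete_eq:
  assumes M: "matroid M" and B0: "B0 \<in> bases M" "B0 \<inter> X = {}"
  shows "delete M X = \<lparr>ground = ground M - X, bases = {B \<in> bases M. B \<inter> X = {}}\<rparr>"
proof -
  have "{I. indep M I \<and> I \<subseteq> ground M - X \<and>
      (\<forall>J. indep M J \<and> J \<subseteq> ground M - X \<and> I \<subseteq> J \<longrightarrow> J = I)} = {B \<in> bases M. B \<inter> X = {}}"
    (is "?L = ?R")
  proof
    show "?L \<subseteq> ?R"
    proof
      fix I assume "I \<in> ?L"
      then have I: "indep M I" "I \<subseteq> ground M - X"
        and max: "\<And>J. indep M J \<Longrightarrow> J \<subseteq> ground M - X \<Longrightarrow> I \<subseteq> J \<Longrightarrow> J = I"
        by simp_all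
      obtain C where C: "C \<in> bases M" "I \<subseteq> C" "C \<subseteq> I \<union> B0"
        using indep_extends_within[OF M I(1) B0(1)] by metis
      have CI: "C = I"
      proof (rule max[OF _ _ C(2)])
        show "C \<subseteq> ground M - X" using C(3) I(2) B0(2) matroidD(3)[OF M C(1)] by auto
        show "indep M C" using C(1) unfolding indep_def by auto
      qed
      show "I \<in> ?R" using C(1) CI I(2) by auto
    qed
    show "?R \<subseteq> ?L"
    proof
      fix B assume B: "B \<in> ?R"
      have "J = B" if J: "indep M J" "B \<subseteq> J" for J
      proof -
        obtain C where C: "C \<in> bases M" "J \<subseteq> C" using J unfolding indep_def by blast
        have "B = C" using B C J by (intro basis_eqI[OF M]) auto
        then show ?thesis using C J by blast
      qed
      moreover have "indep M B" "B \<subseteq> ground M - X"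
        using B matroidD(3)[OF M, of B] unfolding indep_def by auto
      ultimately show "B \<in> ?L" by simp
    qed
  qed
  then show ?thesis by (simp add: delete_def)
qed

lemma matroid_delete:
  assumes M: "matroid M" and B0: "B0 \<in> bases M" "B0 \<inter> X = {}"
  shows "matroid (delete M X)"
  unfolding delete_eq[OF assms] matroid_def
proof (simp, intro conjI ballI allI impI)
  show "finite (ground M - X)" using matroidD(1)[OF M] by simp
  show "\<exists>x. x \<in> bases M \<and> x \<inter> X = {}" using B0 by blast
  fix B assume "B \<in> bases M \<and> B \<inter> X = {}"
  then show "B \<subseteq> ground M - X" using matroidD(3)[OF M] by blast
next
  fix A B x
  assume h: "A \<in> bases M \<and> A \<inter> X = {}" "B \<in> bases M \<and> B \<inter> X = {}" "x \<in> A - B"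
  then obtain y where y: "y \<in> B - A" "insert y (A - {x}) \<in> bases M"
    using matroidD(5)[OF M] by blast
  moreover have "y \<notin> X" "insert y (A - {x}) \<inter> X = {}" using h y by blast+
  ultimately show "\<exists>y\<in>B - A. insert y (A - {x}) \<in> bases M \<and> y \<notin> X \<and> (A - {x}) \<inter> X = {}"
    by blast
qed

lemma contract_props:
  assumes M: "matroid M" and B0: "B0 \<in> bases M" "X \<subseteq> B0"
  shows "matroid (contract M X)"
    and "contract M X = \<lparr>ground = ground M - X, bases = {B - X | B. B \<in> bases M \<and> X \<subseteq> B}\<rparr>"
proof -
  have XE: "X \<subseteq> ground M" using B0(2) matroidD(3)[OF M B0(1)] by (rule subset_trans)
  have D: "matroid (dual M)" "ground M - B0 \<in> bases (dual M)" "(ground M - B0) \<inter> X = {}"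
    using matroid_dual[OF M] B0 by (auto simp: dual_def)
  show "matroid (contract M X)"
    unfolding contract_def by (rule matroid_dual[OF matroid_delete[OF D]])
  have "(\<lambda>B. ground M - X - B) ` {B \<in> bases (dual M). B \<inter> X = {}} =
      {B - X | B. B \<in> bases M \<and> X \<subseteq> B}" (is "?L = ?R")
  proof
    show "?L \<subseteq> ?R"
    proof
      fix Z assume "Z \<in> ?L"
      then obtain B where B: "B \<in> bases M" "(ground M - B) \<inter> X = {}"
        "Z = ground M - X - (ground M - B)" by (auto simp: dual_def)
      then have "X \<subseteq> B" "Z = B - X" using XE matroidD(3)[OF M B(1)] by blast+
      then show "Z \<in> ?R" using B by blast
    qed
    show "?R \<subseteq> ?L"
    proof
      fix Z assume "Z \<in> ?R"
      then obtain B where B: "B \<in> bases M" "X \<subseteq> B" "Z = B - X" by blast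
      have "Z = ground M - X - (ground M - B)" using B matroidD(3)[OF M B(1)] by blast
      moreover have "ground M - B \<in> {B \<in> bases (dual M). B \<inter> X = {}}"
        using B by (auto simp: dual_def)
      ultimately show "Z \<in> ?L" by blast
    qed
  qed
  then show "contract M X = \<lparr>ground = ground M - X, bases = {B - X | B. B \<in> bases M \<and> X \<subseteq> B}\<rparr>"
    unfolding contract_def delete_eq[OF D] by (simp add: dual_def)
qed

lemma is_minor_bases:
  assumes M: "matroid M" and B0: "B0 \<in> bases M" "X \<subseteq> B0" "B0 \<inter> Y = {}" and Y: "Y \<subseteq> ground M"
  shows "is_minor \<lparr>ground = ground M - X - Y,
    bases = {B - X | B. B \<in> bases M \<and> X \<subseteq> B \<and> B \<inter> Y = {}}\<rparr> M"
proof -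
  note c = contract_props[OF M B0(1,2)]
  have XY: "X \<inter> Y = {}" "X \<subseteq> ground M" using B0 matroidD(3)[OF M] by blast+
  have "B0 - X \<in> bases (contract M X)" "(B0 - X) \<inter> Y = {}"
    using B0 by (auto simp: c(2))
  note d = delete_eq[OF c(1) this]
  have "{B \<in> {B - X | B. B \<in> bases M \<and> X \<subseteq> B}. B \<inter> Y = {}} =
      {B - X | B. B \<in> bases M \<and> X \<subseteq> B \<and> B \<inter> Y = {}}"
    using XY by blast
  then have "delete (contract M X) Y = \<lparr>ground = ground M - X - Y,
      bases = {B - X | B. B \<in> bases M \<and> X \<subseteq> B \<and> B \<inter> Y = {}}\<rparr>"
    unfolding d unfolding c(2) by simp
  then show ?thesis unfolding is_minor_def using XY Y by metis
qed

text \<open>If all bases meet \<open>A\<close> in the same number of elements, extending \<open>B \<inter> A\<close> within \<open>C\<close> cannot add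
elements of \<open>A\<close>, and then it must use all of \<open>C - A\<close>.\<close>

lemma bases_glue:
  assumes M: "matroid M" and c: "\<And>B. B \<in> bases M \<Longrightarrow> card (B \<inter> A) = c"
    and B: "B \<in> bases M" "C \<in> bases M"
  shows "(B \<inter> A) \<union> (C - A) \<in> bases M"
proof -
  have "indep M (B \<inter> A)" using B unfolding indep_def by blast
  then obtain D where D: "D \<in> bases M" "B \<inter> A \<subseteq> D" "D \<subseteq> (B \<inter> A) \<union> C"
    using indep_extends_within[OF M _ B(2)] by metis
  have fin: "finite D" "finite C" using matroidD(4)[OF M] D B by auto
  have DA: "B \<inter> A = D \<inter> A"
    using c[OF B(1)] c[OF D(1)] D(2) fin by (intro card_subset_eq) auto
  have "card (D - A) = card (C - A)"
    using c[OF D(1)] c[OF B(2)] card_bases_eq[OF M D(1) B(2)] fin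
      card_Int_Diff[of D A] card_Int_Diff[of C A] by simp
  moreover have "D - A \<subseteq> C - A" using D by blast
  ultimately have "D - A = C - A" using fin by (intro card_subset_eq) auto
  then have "(B \<inter> A) \<union> (C - A) = D" using DA by blast
  then show ?thesis using D by simp
qed

lemma matroid_part:
  assumes M: "matroid M" and c: "\<And>B. B \<in> bases M \<Longrightarrow> card (B \<inter> A) = c"
  shows "matroid \<lparr>ground = ground M \<inter> A, bases = (\<lambda>B. B \<inter> A) ` bases M\<rparr>"
  unfolding matroid_def
proof (simp, intro conjI ballI)
  show "finite (ground M \<inter> A)" "bases M \<noteq> {}" using matroidD[OF M] by auto
  fix B assume "B \<in> bases M"
  then show "B \<inter> A \<subseteq> ground M" using matroidD(3)[OF M] by blast
next
  fix B C x assume h: "B \<in> bases M" "C \<in> bases M" "x \<in> B \<inter> A - C \<inter> A"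
  have D: "(C \<inter> A) \<union> (B - A) \<in> bases M" by (rule bases_glue[OF M c h(2,1)])
  have x: "x \<in> B" "x \<notin> (C \<inter> A) \<union> (B - A)" "x \<in> A" "x \<notin> C" using h by auto
  obtain y where y: "y \<in> (C \<inter> A) \<union> (B - A) - B" "insert y (B - {x}) \<in> bases M"
    using matroidD(5)[OF M h(1) D x(1,2)] by blast
  then have "y \<in> C \<inter> A - B \<inter> A" "insert y (B \<inter> A - {x}) = insert y (B - {x}) \<inter> A" by auto
  then show "\<exists>y\<in>C \<inter> A - B \<inter> A. insert y (B \<inter> A - {x}) \<in> (\<lambda>B. B \<inter> A) ` bases M"
    using y(2) by blast
qed

text \<open>By \<open>bases_glue\<close> the traces of bases on \<open>A\<close> and on its complement combine freely.\<close>

lemma constant_rank_separates: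
  assumes M: "matroid M" and c: "\<And>B. B \<in> bases M \<Longrightarrow> card (B \<inter> A) = c"
    and ne: "ground M \<inter> A \<noteq> {}" "ground M - A \<noteq> {}"
  shows "\<not> connected_matroid M"
proof -
  let ?M1 = "\<lparr>ground = ground M \<inter> A, bases = (\<lambda>B. B \<inter> A) ` bases M\<rparr>"
  let ?M2 = "\<lparr>ground = ground M \<inter> - A, bases = (\<lambda>B. B \<inter> - A) ` bases M\<rparr>"
  obtain B0 where B0: "B0 \<in> bases M" using matroidD(2)[OF M] by blast
  have "card (B \<inter> - A) = card B0 - c" if "B \<in> bases M" for B
    using card_Int_Diff[OF matroidD(4)[OF M that], of A] c[OF that] card_bases_eq[OF M that B0]
    by (simp add: Diff_eq)
  note m = matroid_part[OF M c] matroid_part[OF M this]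
  have "bases M = {A' \<union> B' | A' B'. A' \<in> bases ?M1 \<and> B' \<in> bases ?M2}" (is "_ = ?R")
  proof
    show "bases M \<subseteq> ?R"
    proof
      fix B assume "B \<in> bases M"
      moreover have "B = (B \<inter> A) \<union> (B \<inter> - A)" by blast
      ultimately show "B \<in> ?R" by (simp, blast)
    qed
    show "?R \<subseteq> bases M" using bases_glue[OF M c] by (auto simp: Diff_eq)
  qed
  then have "M = direct_sum ?M1 ?M2"
    by (cases M) (auto simp: direct_sum_def)
  moreover have "ground ?M1 \<noteq> {}" "ground ?M2 \<noteq> {}" "ground ?M1 \<inter> ground ?M2 = {}"
    using ne by auto
  ultimately show ?thesis using m unfolding connected_matroid_def by blast
qed

section \<open>Lattice path matroids and snakes\<close>

text \<open>A lattice path is represented by the set \<open>B\<close> of positions of its north steps; its height after \<open>k\<close> steps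
is then the number of elements of \<open>B\<close> up to \<open>k\<close>, and the bounding paths enter through their
heights \<open>p\<close> and \<open>q\<close> only.\<close>

definition path_sets :: "nat \<Rightarrow> (nat \<Rightarrow> nat) \<Rightarrow> (nat \<Rightarrow> nat) \<Rightarrow> nat set set" where
  "path_sets n p q =
     {B. B \<subseteq> {1..n} \<and> (\<forall>k\<le>n. p k \<le> card (B \<inter> {1..k}) \<and> card (B \<inter> {1..k}) \<le> q k)}"

definition height_function :: "(nat \<Rightarrow> nat) \<Rightarrow> bool" where
  "height_function u \<longleftrightarrow> u 0 = 0 \<and> (\<forall>k. u (Suc k) = u k \<or> u (Suc k) = Suc (u k))"

definition rises :: "nat \<Rightarrow> (nat \<Rightarrow> nat) \<Rightarrow> nat set" where
  "rises n u = {k \<in> {1..n}. u k = Suc (u (k - 1))}"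

lemma height_function_mono:
  assumes "height_function u" "i \<le> j"
  shows "u i \<le> u j" "u j \<le> u i + (j - i)"
proof -
  have "u i \<le> u j \<and> u j \<le> u i + (j - i)"
    using assms(2)
  proof (induction j rule: dec_induct)
    case (step j)
    have "u (Suc j) = u j \<or> u (Suc j) = Suc (u j)" using assms(1) by (simp add: height_function_def)
    then show ?case using step by auto
  qed simp
  then show "u i \<le> u j" "u j \<le> u i + (j - i)" by auto
qed

lemma card_Int_Suc:
  "card (B \<inter> {1..Suc k}) = card (B \<inter> {1..k}) + (if Suc k \<in> B then 1 else 0)"
proof -
  have "B \<inter> {1..Suc k} = (if Suc k \<in> B then insert (Suc k) (B \<inter> {1..k}) else B \<inter> {1..k})"
    by (auto simp: le_Suc_eq)
  then show ?thesis by simp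
qed

lemma card_rises:
  assumes "height_function u" "k \<le> n"
  shows "card (rises n u \<inter> {1..k}) = u k"
  using assms(2)
proof (induction k)
  case 0
  then show ?case using assms(1) by (simp add: height_function_def)
next
  case (Suc k)
  have "Suc k \<in> rises n u \<longleftrightarrow> u (Suc k) = Suc (u k)" using Suc by (simp add: rises_def)
  moreover have "u (Suc k) = u k \<or> u (Suc k) = Suc (u k)" using assms(1) by (simp add: height_function_def)
  ultimately show ?case using Suc unfolding card_Int_Suc by auto
qed

lemma rises_in_path_sets:
  assumes "height_function u" "\<And>k. k \<le> n \<Longrightarrow> p k \<le> u k \<and> u k \<le> q k"
  shows "rises n u \<in> path_sets n p q"
  using assms card_rises[OF assms(1)] by (auto simp: path_sets_def rises_def)

abbreviation height :: "step list \<Rightarrow> nat \<Rightarrow> nat" where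
  "height w k \<equiv> count_list (take k w) North"

lemma height_Suc:
  "height w (Suc k) = height w k + (if k < length w \<and> w ! k = North then 1 else 0)"
  by (cases "k < length w") (simp_all add: take_Suc_conv_app_nth)

lemma height_function_height: "height_function (height w)"
  unfolding height_function_def height_Suc by simp

lemma card_north_positions: "card (north_positions w \<inter> {1..k}) = height w k"
proof (induction k)
  case (Suc k)
  have "Suc k \<in> north_positions w \<longleftrightarrow> k < length w \<and> w ! k = North"
    by (auto simp: north_positions_def)
  then show ?case using Suc unfolding card_Int_Suc height_Suc by simp
qed simp

lemma length_lattice_path:
  assumes "w \<in> lattice_paths m r"
  shows "length w = m + r"
proof -
  have "length w = count_list w East + count_list w North"
    by (induction w) (auto intro: step.exhaust)
  then show ?thesis using assms by (simp add: lattice_paths_def)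
qed

lemma height_end:
  assumes "w \<in> lattice_paths m r" "k \<ge> m + r"
  shows "height w k = r"
  using assms length_lattice_path[OF assms(1)] by (simp add: lattice_paths_def)

lemma bases_lattice_path_matroid:
  assumes P: "P \<in> lattice_paths m r" and Q: "Q \<in> lattice_paths m r"
  shows "bases (lattice_path_matroid m r P Q) = path_sets (m + r) (height P) (height Q)"
proof -
  have "B \<in> path_sets (m + r) (height P) (height Q)"
    if "R \<in> lattice_paths m r" "weakly_below P R" "weakly_below R Q" "B = north_positions R" for B R
  proof -
    have "north_positions R \<subseteq> {1..m + r}"
      using length_lattice_path[OF that(1)] by (auto simp: north_positions_def)
    then show ?thesis
      unfolding path_sets_def \<open>B = _\<close> mem_Collect_eq card_north_positions
      using that(2,3) by (simp add: weakly_below_def)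
  qed
  moreover have "B \<in> north_positions ` {R \<in> lattice_paths m r. weakly_below P R \<and> weakly_below R Q}"
    if B: "B \<in> path_sets (m + r) (height P) (height Q)" for B
  proof -
    define R where "R = map (\<lambda>i. if Suc i \<in> B then North else East) [0..<m + r]"
    have len: "length R = m + r" by (simp add: R_def)
    have nth: "R ! i = North \<longleftrightarrow> Suc i \<in> B" if "i < m + r" for i
      using that by (simp add: R_def)
    have BR: "north_positions R = B"
    proof (rule set_eqI)
      fix i
      show "i \<in> north_positions R \<longleftrightarrow> i \<in> B"
      proof (cases i)
        case 0
        then show ?thesis using B by (auto simp: north_positions_def path_sets_def)
      next
        case (Suc j)
        then show ?thesis using B nth[of j] by (auto simp: north_positions_def path_sets_def len)
      qed
    qed
    have hR: "height P k \<le> height R k \<and> height R k \<le> height Q k" if "k \<le> m + r" for k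
      using that B unfolding BR[symmetric] path_sets_def mem_Collect_eq card_north_positions by blast
    have hend: "height R k = r" if "k \<ge> m + r" for k
      using hR[of "m + r"] height_end[OF P, of "m + r"] height_end[OF Q, of "m + r"] that len by simp
    have "height P k \<le> height R k \<and> height R k \<le> height Q k" for k
    proof (cases "k \<le> m + r")
      case False
      then have "k \<ge> m + r" by simp
      then show ?thesis using hend height_end[OF P] height_end[OF Q] by simp
    qed (rule hR)
    then have wb: "weakly_below P R" "weakly_below R Q" by (auto simp: weakly_below_def)
    have "count_list R North = r" using hend[of "m + r"] len by simp
    moreover have "length R = count_list R East + count_list R North"
      by (induction R) (auto intro: step.exhaust)
    ultimately have "R \<in> lattice_paths m r" using len by (simp add: lattice_paths_def)
    then show ?thesis using wb BR by blast
  qed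
  ultimately show ?thesis by (auto simp: lattice_path_matroid_def)
qed

lemma image_Int_card:
  assumes "inj_on e {1..n}" "B \<subseteq> {1..n::nat}" "k \<le> n"
  shows "card (e ` B \<inter> e ` {1..k}) = card (B \<inter> {1..k})"
proof -
  have "e ` B \<inter> e ` {1..k} = e ` (B \<inter> {1..k})"
    using assms by (intro inj_on_image_Int[symmetric]) auto
  moreover have "inj_on e (B \<inter> {1..k})" using assms by (auto intro: inj_on_subset)
  ultimately show ?thesis by (simp add: card_image)
qed

text \<open>All paths have the same height where the bounding paths touch, so every basis has the same number of elements
up to that position.\<close>

lemma touching_paths_disconnected:
  assumes M: "matroid M" and e: "inj_on e {1..n}" and gr: "ground M = e ` {1..n}"
    and ba: "bases M = (`) e ` path_sets n p q"
    and k: "0 < k" "k < n" "p k = q k"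
  shows "\<not> connected_matroid M"
proof (rule constant_rank_separates[OF M, where A = "e ` {1..k}" and c = "p k"])
  fix B assume "B \<in> bases M"
  then obtain B' where B': "B' \<in> path_sets n p q" "B = e ` B'" using ba by blast
  then have "B' \<subseteq> {1..n}" "p k \<le> card (B' \<inter> {1..k})" "card (B' \<inter> {1..k}) \<le> q k"
    using less_imp_le[OF k(2)] unfolding path_sets_def by blast+
  then show "card (B \<inter> e ` {1..k}) = p k"
    using image_Int_card[OF e, of B' k] k B'(2) by simp
next
  have "e 1 \<in> e ` {1..n} \<inter> e ` {1..k}" using k by auto
  then show "ground M \<inter> e ` {1..k} \<noteq> {}" unfolding gr by blast
  have "e n \<notin> e ` {1..k}"
  proof
    assume "e n \<in> e ` {1..k}"
    then obtain j where j: "j \<in> {1..k}" "e j = e n" by auto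
    then have "j = n" using e k by (intro inj_onD[OF e]) auto
    then show False using j k by simp
  qed
  moreover have "e n \<in> e ` {1..n}" using k by auto
  ultimately show "ground M - e ` {1..k} \<noteq> {}" unfolding gr by blast
qed

lemma card_Int_block:
  fixes X :: "nat set"
  assumes "X \<subseteq> {1..n}" "a \<le> k"
  shows "card (X \<inter> {1..k}) = card (X \<inter> {1..a}) + card (X \<inter> {a<..k})"
proof -
  have "X \<inter> {1..k} = (X \<inter> {1..a}) \<union> (X \<inter> {a<..k})" using assms by auto
  then show ?thesis by (simp add: card_Un_disjoint disjoint_iff)
qed

text \<open>Where the bounding paths are at least two apart, the four steps around that position can be chosen freely among
those with two north steps, once the rest of the path enters the block at its lower left corner and leaves
it at the upper right one.\<close>

lemma wide_paths_block:
  assumes p: "height_function p" and q: "height_function q"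
    and pq: "\<And>k. k \<le> n \<Longrightarrow> p k \<le> q k" and pn: "p n = q n"
    and wide: "k \<le> n" "p k + 2 \<le> q k"
  obtains a B0 where "a + 4 \<le> n" "B0 \<in> path_sets n p q" "card (B0 \<inter> {a<..a+4}) = 2"
    "\<And>C. C \<subseteq> {a<..a+4} \<Longrightarrow> card C = 2 \<Longrightarrow> (B0 - {a<..a+4}) \<union> C \<in> path_sets n p q"
proof -
  have p0: "p 0 = 0" "q 0 = 0" using p q by (auto simp: height_function_def)
  have "k \<ge> 2" using height_function_mono(2)[OF q, of 0 k] p0 wide by simp
  \<comment> \<open>The block consists of the steps \<open>a + 1\<close> to \<open>a + 4\<close>, with the wide place in the middle.\<close>
  then obtain a where a: "k = a + 2" by (metis add.commute le_Suc_ex)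
  have "q k \<le> p k + (n - k)"
    using height_function_mono(2)[OF p, of k n] height_function_mono(1)[OF q, of k n] pn wide by simp
  then have an: "a + 4 \<le> n" using a wide by simp
  define g where "g = p (a + 2)"
  have g: "p (a + 2) = g" "g + 2 \<le> q (a + 2)" using wide a by (auto simp: g_def)
  have pb: "p (a + j) \<le> g" if "j \<le> 2" for j
    using height_function_mono(1)[OF p, of "a + j" "a + 2"] that g by simp
  have qb: "g + 2 \<le> q (a + j)" if "j \<ge> 2" for j
    using height_function_mono(1)[OF q, of "a + 2" "a + j"] that g by simp
  have "p (a + 3) \<le> g + 1" "p (a + 4) \<le> g + 2" "g \<le> q a" "g + 1 \<le> q (a + 1)"
    using height_function_mono(2)[OF p, of "a + 2" "a + 3"] height_function_mono(2)[OF p, of "a + 2" "a + 4"]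
      height_function_mono(2)[OF q, of a "a + 2"] height_function_mono(2)[OF q, of "a + 1" "a + 2"] g
    by simp_all
  note bnd = this pb[of 0] pb[of 1] pb[of 2] qb[of 2] qb[of 3] qb[of 4]
  \<comment> \<open>A path along the upper boundary until height \<open>g\<close>, then through the block with its north
    steps last, then along height \<open>g + 2\<close> until it meets the lower boundary.\<close>
  define u where "u j = (if j \<le> a + 2 then min (q j) g else if j = a + 3 then g + 1 else max (p j) (g + 2))" for j
  have ua: "u a = g" "u (a + 4) = g + 2" using bnd by (auto simp: u_def)
  have hu: "height_function u"
    unfolding height_function_def
  proof (intro conjI allI)
    show "u 0 = 0" using p0 by (simp add: u_def)
    fix j
    have ps: "p (Suc j) = p j \<or> p (Suc j) = Suc (p j)" and qs: "q (Suc j) = q j \<or> q (Suc j) = Suc (q j)"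
      using p q by (auto simp: height_function_def)
    consider "Suc j \<le> a + 2" | "j = a + 2" | "j = a + 3" | "j \<ge> a + 4" by linarith
    then show "u (Suc j) = u j \<or> u (Suc j) = Suc (u j)"
    proof cases
      case 1
      then show ?thesis using qs by (auto simp: u_def)
    next
      case 2
      then show ?thesis using bnd by (simp add: u_def eval_nat_numeral)
    next
      case 3
      then show ?thesis using bnd by (simp add: u_def eval_nat_numeral)
    next
      case 4
      then show ?thesis using ps by (auto simp: u_def max_def)
    qed
  qed
  have ub: "p j \<le> u j \<and> u j \<le> q j" if "j \<le> n" for j
  proof -
    consider "j \<le> a + 2" | "j = a + 3" | "j \<ge> a + 4" by linarith
    then show ?thesis
    proof cases
      case 1
      then show ?thesis using height_function_mono(1)[OF p 1] g pq[OF that] by (simp add: u_def)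
    next
      case 2
      then show ?thesis using bnd by (simp add: u_def)
    next
      case 3
      then have "g + 2 \<le> q j" using height_function_mono(1)[OF q, of "a + 2" j] g by simp
      then show ?thesis using 3 pq[OF that] by (simp add: u_def)
    qed
  qed
  define B0 where "B0 = rises n u"
  have B0: "B0 \<in> path_sets n p q" unfolding B0_def by (rule rises_in_path_sets[OF hu ub])
  have B0n: "B0 \<subseteq> {1..n}" by (auto simp: B0_def rises_def)
  have B0c: "card (B0 \<inter> {1..j}) = u j" if "j \<le> n" for j
    unfolding B0_def by (rule card_rises[OF hu that])
  have B02: "card (B0 \<inter> {a<..a+4}) = 2"
    using card_Int_block[OF B0n, of a "a + 4"] B0c[of a] B0c[of "a + 4"] an ua by simp
  have "(B0 - {a<..a+4}) \<union> C \<in> path_sets n p q" if C: "C \<subseteq> {a<..a+4}" "card C = 2" for C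
  proof -
    let ?B = "(B0 - {a<..a+4}) \<union> C"
    have finC: "finite C" using C finite_subset by blast
    have Bn: "?B \<subseteq> {1..n}" using B0n C an by auto
    have low: "?B \<inter> {1..j} = B0 \<inter> {1..j}" if "j \<le> a" for j using that C by auto
    have mid: "card (?B \<inter> {1..j}) = g + card (C \<inter> {a<..j})" if "a \<le> j" "j \<le> a + 4" for j
    proof -
      have "?B \<inter> {a<..j} = C \<inter> {a<..j}" using that by auto
      then show ?thesis
        using card_Int_block[OF Bn that(1)] low[of a] B0c[of a] an ua by simp
    qed
    have c4: "C \<inter> {a<..a+4} = C" using C by blast
    have drop: "card C \<le> card (C \<inter> {a<..j}) + (a + 4 - j)" if "a \<le> j" for j
    proof -
      have "C \<subseteq> (C \<inter> {a<..j}) \<union> {j<..a+4}" using C by auto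
      then have "card C \<le> card ((C \<inter> {a<..j}) \<union> {j<..a+4})" using finC by (intro card_mono) auto
      also have "\<dots> \<le> card (C \<inter> {a<..j}) + card {j<..a+4}" by (rule card_Un_le)
      finally show ?thesis by simp
    qed
    have le2: "card (C \<inter> {a<..j}) \<le> 2" for j using C(2) card_mono[OF finC, of "C \<inter> {a<..j}"] by simp
    have lej: "card (C \<inter> {a<..j}) \<le> j - a" for j
      using card_mono[of "{a<..j}" "C \<inter> {a<..j}"] by simp
    have "p j \<le> card (?B \<inter> {1..j}) \<and> card (?B \<inter> {1..j}) \<le> q j" if j: "j \<le> n" for j
    proof -
      consider "j \<le> a" | "j = a + 1" | "j = a + 2" | "j = a + 3" | "j \<ge> a + 4" by linarith
      then show ?thesis
      proof cases
        case 1
        then show ?thesis using low[OF 1] B0c[OF j] ub[OF j] by simp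
      next
        case 2
        then show ?thesis using mid[of j] lej[of j] bnd by simp
      next
        case 3
        then show ?thesis using mid[of j] lej[of j] bnd by simp
      next
        case 4
        then show ?thesis using mid[of j] le2[of j] drop[of j] C(2) bnd by simp
      next
        case 5
        have "?B \<inter> {a+4<..j} = B0 \<inter> {a+4<..j}" using C by auto
        moreover have "card (?B \<inter> {1..a+4}) = u (a + 4)" using mid[of "a + 4"] c4 C(2) ua by simp
        ultimately have "card (?B \<inter> {1..j}) = u j"
          using card_Int_block[OF Bn 5] card_Int_block[OF B0n 5] B0c[of "a + 4"] B0c[OF j] an by simp
        then show ?thesis using ub[OF j] by simp
      qed
    qed
    then show ?thesis using Bn by (simp add: path_sets_def)
  qed
  then show ?thesis using that an B0 B02 by blast
qed

text \<open>Contract the north steps of \<open>B0\<close> outside the block and delete its east steps outside the block; the bases that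
survive are the paths which agree with \<open>B0\<close> outside the block.\<close>

lemma wide_paths_U24_minor:
  assumes M: "matroid M" and e: "inj_on e {1..n}" and gr: "ground M = e ` {1..n}"
    and ba: "bases M = (`) e ` path_sets n p q"
    and p: "height_function p" and q: "height_function q"
    and pq: "\<And>k. k \<le> n \<Longrightarrow> p k \<le> q k" and pn: "p n = q n"
    and wide: "k \<le> n" "p k + 2 \<le> q k"
  shows "\<exists>N. is_minor N M \<and> isomorphic N (uniform_matroid 2 4)"
proof -
  obtain a B0 where an: "a + 4 \<le> n" and B0: "B0 \<in> path_sets n p q"
    and B02: "card (B0 \<inter> {a<..a+4}) = 2"
    and C: "\<And>C. C \<subseteq> {a<..a+4} \<Longrightarrow> card C = 2 \<Longrightarrow> (B0 - {a<..a+4}) \<union> C \<in> path_sets n p q"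
    using wide_paths_block[OF p q pq pn wide] by metis
  let ?D = "{a<..a+4}"
  let ?X = "B0 - ?D" and ?Y = "{1..n} - B0 - ?D"
  have sub: "B \<subseteq> {1..n}" if "B \<in> path_sets n p q" for B using that by (simp add: path_sets_def)
  have cardB: "card B = p n" if "B \<in> path_sets n p q" for B
  proof -
    have "B \<inter> {1..n} = B" using sub[OF that] by blast
    then show ?thesis using that pn unfolding path_sets_def by (metis (mono_tags, lifting) antisym mem_Collect_eq order_refl)
  qed
  have Dn: "?D \<subseteq> {1..n}" using an by auto
  have B0n: "B0 \<subseteq> {1..n}" using sub B0 .
  have inv: "inv_into {1..n} e (e i) = i" if "i \<in> {1..n}" for i using e that by simp
  have im_sub: "e ` S \<subseteq> e ` T \<longleftrightarrow> S \<subseteq> T" if "S \<subseteq> {1..n}" "T \<subseteq> {1..n}" for S T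
    using inj_on_image_subset_iff[OF e that] .
  define N where "N = \<lparr>ground = ground M - e ` ?X - e ` ?Y,
    bases = {B - e ` ?X | B. B \<in> bases M \<and> e ` ?X \<subseteq> B \<and> B \<inter> e ` ?Y = {}}\<rparr>"
  have "is_minor N M"
    unfolding N_def
  proof (rule is_minor_bases[OF M])
    show "e ` B0 \<in> bases M" using ba B0 by blast
    show "e ` ?X \<subseteq> e ` B0" by blast
    have "e ` B0 \<inter> e ` ?Y = e ` (B0 \<inter> ?Y)"
      using B0n by (intro inj_on_image_Int[OF e, symmetric]) auto
    also have "B0 \<inter> ?Y = {}" by blast
    finally show "e ` B0 \<inter> e ` ?Y = {}" by simp
    show "e ` ?Y \<subseteq> ground M" unfolding gr by blast
  qed
  moreover have grN: "ground N = e ` ?D"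
  proof -
    have "e ` {1..n} - e ` ?X - e ` ?Y = e ` ({1..n} - ?X - ?Y)"
      using B0n e by (simp add: inj_on_image_set_diff[OF e] Diff_subset subset_trans[OF Diff_subset])
    moreover have "{1..n} - ?X - ?Y = ?D" using Dn B0n by blast
    ultimately show ?thesis unfolding N_def gr by simp
  qed
  moreover have baN: "bases N = (`) e ` {C. C \<subseteq> ?D \<and> card C = 2}" (is "_ = ?R")
  proof
    show "bases N \<subseteq> ?R"
    proof
      fix Z assume "Z \<in> bases N"
      then obtain B' where B': "B' \<in> bases M" "e ` ?X \<subseteq> B'" "B' \<inter> e ` ?Y = {}" "Z = B' - e ` ?X"
        unfolding N_def by auto
      obtain B where B: "B \<in> path_sets n p q" "B' = e ` B" using B'(1) ba by blast
      note Bn = sub[OF B(1)]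
      have XB: "?X \<subseteq> B" using B'(2) B(2) im_sub[of ?X B] B0n Bn by blast
      have "B \<inter> ?Y = {}" using B'(3) B(2) by blast
      then have BX: "B - ?X = B \<inter> ?D" "B - ?D = B0 - ?D" using Bn XB by blast+
      have "card (B \<inter> ?D) + card (B - ?D) = card (B0 \<inter> ?D) + card (B0 - ?D)"
        using cardB[OF B(1)] cardB[OF B0] card_Int_Diff[of B ?D] card_Int_Diff[of B0 ?D]
          finite_subset[OF Bn] finite_subset[OF B0n] by simp
      then have "card (B \<inter> ?D) = 2" using BX B02 by simp
      moreover have "Z = e ` (B \<inter> ?D)"
        unfolding B'(4) B(2) BX(1)[symmetric]
        using Bn B0n by (intro inj_on_image_set_diff[OF e, symmetric]) auto
      ultimately show "Z \<in> ?R" by blast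
    qed
    show "?R \<subseteq> bases N"
    proof
      fix Z assume "Z \<in> ?R"
      then obtain C' where C': "C' \<subseteq> ?D" "card C' = 2" "Z = e ` C'" by blast
      let ?B = "?X \<union> C'"
      have 1: "e ` ?B \<in> bases M" using C[OF C'(1,2)] ba by blast
      have Bn: "?B \<subseteq> {1..n}" using B0n C'(1) Dn by blast
      have "e ` ?B \<inter> e ` ?Y = e ` (?B \<inter> ?Y)"
        using Bn by (intro inj_on_image_Int[OF e, symmetric]) auto
      also have "?B \<inter> ?Y = {}" using C'(1) by blast
      finally have 2: "e ` ?B \<inter> e ` ?Y = {}" by simp
      have "e ` ?B - e ` ?X = e ` (?B - ?X)"
        using Bn B0n by (intro inj_on_image_set_diff[OF e, symmetric]) auto
      also have "?B - ?X = C'" using C'(1) by blast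
      finally have "Z = e ` ?B - e ` ?X" using C'(3) by simp
      moreover have "e ` ?X \<subseteq> e ` ?B" by blast
      ultimately have "\<exists>B. Z = B - e ` ?X \<and> B \<in> bases M \<and> e ` ?X \<subseteq> B \<and> B \<inter> e ` ?Y = {}"
        using 1 2 by metis
      then show "Z \<in> bases N" unfolding N_def by simp
    qed
  qed
  moreover have "isomorphic N (uniform_matroid 2 4)"
  proof -
    let ?f = "\<lambda>x. inv_into {1..n} e x - a"
    have fe: "?f (e i) = i - a" if "i \<in> ?D" for i using inv[of i] that Dn by auto
    have fim: "?f ` (e ` C) = (\<lambda>i. i - a) ` C" if "C \<subseteq> ?D" for C
      unfolding image_image using that fe by (intro image_cong) auto
    have bij: "bij_betw (\<lambda>i. i - a) ?D {1..4}"
      by (rule bij_betw_byWitness[where f' = "\<lambda>i. i + a"]) auto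
    have "bij_betw ?f (e ` ?D) {1..4}"
      unfolding bij_betw_def
    proof
      show "?f ` (e ` ?D) = {1..4}" using fim[of ?D] bij by (simp add: bij_betw_def)
      show "inj_on ?f (e ` ?D)"
      proof (rule inj_onI)
        fix x y assume "x \<in> e ` ?D" "y \<in> e ` ?D" and eq: "?f x = ?f y"
        then obtain i j where ij: "i \<in> ?D" "x = e i" "j \<in> ?D" "y = e j" by blast
        then have "i - a = j - a" using eq fe by simp
        then have "i = j" using ij(1,3) unfolding greaterThanAtMost_iff by linarith
        then show "x = y" using ij by simp
      qed
    qed
    moreover have "{B. B \<subseteq> {1..4} \<and> card B = 2} = (\<lambda>B. ?f ` B) ` bases N" (is "?U = _")
    proof -
      have "(\<lambda>B. ?f ` B) ` bases N = (\<lambda>C. ?f ` (e ` C)) ` {C. C \<subseteq> ?D \<and> card C = 2}"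
        unfolding baN by (rule image_image)
      also have "\<dots> = (\<lambda>C. (\<lambda>i. i - a) ` C) ` {C. C \<subseteq> ?D \<and> card C = 2}"
        by (rule image_cong[OF refl], rule fim) blast
      also have "\<dots> = ?U"
      proof
        show "(\<lambda>C. (\<lambda>i. i - a) ` C) ` {C. C \<subseteq> ?D \<and> card C = 2} \<subseteq> ?U"
          using bij by (auto simp: bij_betw_def card_image inj_on_subset)
        show "?U \<subseteq> (\<lambda>C. (\<lambda>i. i - a) ` C) ` {C. C \<subseteq> ?D \<and> card C = 2}"
        proof
          fix B assume B: "B \<in> ?U"
          have "B = (\<lambda>i. i - a) ` ((\<lambda>i. i + a) ` B)" by (simp add: image_image)
          moreover have "(\<lambda>i. i + a) ` B \<subseteq> ?D" using B by fastforce
          moreover have "card ((\<lambda>i. i + a) ` B) = 2" using B by (simp add: card_image)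
          ultimately show "B \<in> (\<lambda>C. (\<lambda>i. i - a) ` C) ` {C. C \<subseteq> ?D \<and> card C = 2}" by blast
        qed
      qed
      finally show ?thesis ..
    qed
    ultimately show ?thesis
      unfolding isomorphic_def uniform_matroid_def grN by (intro exI[of _ ?f]) simp
  qed
  ultimately show ?thesis by blast
qed

text \<open>The map \<open>e\<close> is the inverse of the isomorphism onto a lattice path matroid. Connectedness forbids that the
bounding paths touch at an inner position, and the excluded minor keeps them within distance one.\<close>

lemma snake_matroid_paths:
  assumes "snake_matroid M"
  obtains n e p q where "2 \<le> n" "inj_on e {1..n}" "ground M = e ` {1..n}"
    "bases M = (`) e ` path_sets n p q" "height_function p" "height_function q" "p n = q n"
    "\<forall>k\<in>{0<..<n}. q k = Suc (p k)"
proof -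
  have M: "matroid M" and c2: "2 \<le> card (ground M)" and conn: "connected_matroid M"
    and nomin: "\<not> (\<exists>N. is_minor N M \<and> isomorphic N (uniform_matroid 2 4))"
    using assms by (simp_all add: snake_matroid_def)
  obtain L where L: "is_lattice_path_matroid L" "isomorphic M L"
    using assms by (auto simp: snake_matroid_def)
  obtain m r P Q where PQ: "P \<in> lattice_paths m r" "Q \<in> lattice_paths m r" "weakly_below P Q"
    and LL: "L = lattice_path_matroid m r P Q"
    using L(1) unfolding is_lattice_path_matroid_def by blast
  define n where "n = m + r"
  have gL: "ground L = {1..n}" by (simp add: LL lattice_path_matroid_def n_def)
  have bL: "bases L = path_sets n (height P) (height Q)"
    unfolding LL n_def by (rule bases_lattice_path_matroid[OF PQ(1,2)])
  obtain f where f: "bij_betw f (ground M) {1..n}" "bases L = (\<lambda>B. f ` B) ` bases M"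
    using L(2) unfolding isomorphic_def gL by blast
  define e where "e = inv_into (ground M) f"
  have e: "bij_betw e {1..n} (ground M)" unfolding e_def by (rule bij_betw_inv_into[OF f(1)])
  have inj: "inj_on e {1..n}" and gr: "ground M = e ` {1..n}" using e by (auto simp: bij_betw_def)
  have ef: "e ` f ` B = B" if "B \<subseteq> ground M" for B
    using that f(1) unfolding e_def by (intro inv_into_image_cancel) (auto simp: bij_betw_def)
  have "(`) e ` bases L = (\<lambda>B. B) ` bases M"
    unfolding f(2) image_image using ef matroidD(3)[OF M] by (intro image_cong) (auto simp: image_image)
  then have ba: "bases M = (`) e ` path_sets n (height P) (height Q)" unfolding bL by simp
  have n2: "2 \<le> n" using c2 bij_betw_same_card[OF f(1)] by simp
  have le: "height P k \<le> height Q k" for k using PQ(3) by (simp add: weakly_below_def)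
  have pn: "height P n = height Q n"
    using height_end[OF PQ(1), of n] height_end[OF PQ(2), of n] by (simp add: n_def)
  note hf = height_function_height[of P] height_function_height[of Q]
  have "height Q k = Suc (height P k)" if k: "0 < k" "k < n" for k
  proof -
    have "height P k \<noteq> height Q k"
      using touching_paths_disconnected[OF M inj gr ba k] conn by blast
    moreover have "\<not> height P k + 2 \<le> height Q k"
      using wide_paths_U24_minor[OF M inj gr ba hf le pn] nomin k by (metis less_imp_le)
    ultimately show ?thesis using le[of k] by linarith
  qed
  then show ?thesis using that[OF n2 inj gr ba hf pn] by simp
qed

section \<open>Lattice points of dilated snake polytopes\<close>

abbreviation incidence :: "'n::finite set \<Rightarrow> real ^ 'n" where
  "incidence B \<equiv> \<Sum>i\<in>B. axis i 1"

lemma incidence_nth: "incidence B $ i = (if i \<in> B then 1 else 0)"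
  by (simp add: axis_def sum.delta if_distrib cong: if_cong)

definition dilation_points :: "('n::finite) matroid_data \<Rightarrow> nat \<Rightarrow> (real ^ 'n) set" where
  "dilation_points M t = (\<lambda>x. real t *\<^sub>R x) ` base_polytope M \<inter> integer_points"

text \<open>Hermite's identity. Increasing \<open>s\<close> by one drops the first summand and appends \<open>(s + t) div t\<close>, which is
larger by one.\<close>

lemma sum_div_shift:
  assumes "t > 0"
  shows "(\<Sum>j<t. (s + j) div t) = (s::nat)"
proof (induction s)
  case 0
  then show ?case by simp
next
  case (Suc s)
  let ?g = "\<lambda>j. (s + j) div t"
  have "(\<Sum>j<Suc t. ?g j) = ?g 0 + (\<Sum>j<t. ?g (Suc j))" by (rule sum.lessThan_Suc_shift)
  then have "(\<Sum>j<t. ?g j) + (s + t) div t = s div t + (\<Sum>j<t. (Suc s + j) div t)" by simp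
  moreover have "(s + t) div t = s div t + 1" using assms by simp
  ultimately show ?case using Suc.IH by linarith
qed

text \<open>These linear inequalities hold at the vertices, hence on their convex hull.\<close>

lemma base_polytope_path_sets:
  fixes M :: "('n::finite) matroid_data"
  assumes e: "inj_on e {1..n}" and ba: "bases M = (`) e ` path_sets n p q"
    and x: "x \<in> base_polytope M"
  shows "i \<notin> e ` {1..n} \<Longrightarrow> x $ i = 0" "0 \<le> x $ i" "x $ i \<le> 1"
    "k \<le> n \<Longrightarrow> real (p k) \<le> (\<Sum>i\<in>{1..k}. x $ e i)" "k \<le> n \<Longrightarrow> (\<Sum>i\<in>{1..k}. x $ e i) \<le> real (q k)"
proof -
  define K where "K = {x :: real ^ 'n. (\<forall>i. i \<notin> e ` {1..n} \<longrightarrow> x $ i = 0) \<and> (\<forall>i. 0 \<le> x $ i \<and> x $ i \<le> 1) \<and>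
    (\<forall>k\<le>n. real (p k) \<le> (\<Sum>i\<in>{1..k}. x $ e i) \<and> (\<Sum>i\<in>{1..k}. x $ e i) \<le> real (q k))}"
  have between: "l \<le> u * a + v * b \<and> u * a + v * b \<le> h"
    if "0 \<le> u" "0 \<le> v" "u + v = 1" "l \<le> a" "a \<le> h" "l \<le> b" "b \<le> h" for l h u v a b :: real
  proof -
    have "convex {l..h}" by simp
    from convexD[OF this _ _ that(1-3), of a b] show ?thesis using that by auto
  qed
  have "convex K"
    unfolding convex_def
  proof (intro ballI allI impI)
    fix x y u v assume xy: "x \<in> K" "y \<in> K" and uv: "(0::real) \<le> u" "0 \<le> v" "u + v = 1"
    have s: "(\<Sum>i\<in>A. (u *\<^sub>R x + v *\<^sub>R y) $ e i) = u * (\<Sum>i\<in>A. x $ e i) + v * (\<Sum>i\<in>A. y $ e i)" for A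
      by (simp add: sum.distrib sum_distrib_left)
    show "u *\<^sub>R x + v *\<^sub>R y \<in> K"
      unfolding K_def mem_Collect_eq s
    proof (intro conjI allI impI)
      fix i
      show "i \<notin> e ` {1..n} \<Longrightarrow> (u *\<^sub>R x + v *\<^sub>R y) $ i = 0" using xy by (simp add: K_def)
      show "0 \<le> (u *\<^sub>R x + v *\<^sub>R y) $ i" "(u *\<^sub>R x + v *\<^sub>R y) $ i \<le> 1"
        using between[OF uv, of 0 "x $ i" 1 "y $ i"] xy by (simp_all add: K_def)
    next
      fix k assume k: "k \<le> n"
      show "real (p k) \<le> u * (\<Sum>i\<in>{1..k}. x $ e i) + v * (\<Sum>i\<in>{1..k}. y $ e i)"
        "u * (\<Sum>i\<in>{1..k}. x $ e i) + v * (\<Sum>i\<in>{1..k}. y $ e i) \<le> real (q k)"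
        using between[OF uv, of "real (p k)" "\<Sum>i\<in>{1..k}. x $ e i" "real (q k)" "\<Sum>i\<in>{1..k}. y $ e i"]
          xy k unfolding K_def mem_Collect_eq by blast+
    qed
  qed
  moreover have "incidence B \<in> K" if "B \<in> bases M" for B
  proof -
    obtain B' where B': "B' \<in> path_sets n p q" "B = e ` B'" using \<open>B \<in> bases M\<close> ba by blast
    have B'n: "B' \<subseteq> {1..n}" and B'c: "\<forall>k\<le>n. p k \<le> card (B' \<inter> {1..k}) \<and> card (B' \<inter> {1..k}) \<le> q k"
      using B'(1) unfolding path_sets_def by blast+
    have s: "(\<Sum>i\<in>{1..k}. incidence B $ e i) = real (card (B' \<inter> {1..k}))" if "k \<le> n" for k
    proof -
      have "(\<Sum>i\<in>{1..k}. incidence B $ e i) = (\<Sum>i\<in>{1..k}. if i \<in> B' then 1 else 0)"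
      proof (rule sum.cong[OF refl])
        fix i assume "i \<in> {1..k}"
        then have "e i \<in> B \<longleftrightarrow> i \<in> B'"
          using that B'n e B'(2) by (auto simp: inj_on_image_mem_iff)
        then show "incidence B $ e i = (if i \<in> B' then 1 else 0)" by (simp add: incidence_nth del: sum_component)
      qed
      also have "\<dots> = real (card (B' \<inter> {1..k}))"
        by (simp add: sum.If_cases Int_commute)
      finally show ?thesis .
    qed
    have "i \<notin> B" if "i \<notin> e ` {1..n}" for i using that B'n B'(2) by blast
    then show ?thesis
      unfolding K_def mem_Collect_eq using B'c s
      by (simp add: incidence_nth del: sum_component)
  qed
  ultimately have "base_polytope M \<subseteq> K"
    unfolding base_polytope_def by (intro hull_minimal) auto
  then have xK: "x \<in> K" using x by blast
  show "i \<notin> e ` {1..n} \<Longrightarrow> x $ i = 0" "0 \<le> x $ i" "x $ i \<le> 1" using xK by (simp_all add: K_def)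
  show "k \<le> n \<Longrightarrow> real (p k) \<le> (\<Sum>i\<in>{1..k}. x $ e i)" "k \<le> n \<Longrightarrow> (\<Sum>i\<in>{1..k}. x $ e i) \<le> real (q k)"
    using xK unfolding K_def by blast+
qed

text \<open>A point with partial sums \<open>s\<close> is the sum of the incidence vectors of \<open>t\<close> paths, and so \<open>t\<close> times their
average. The \<open>j\<close>-th path has heights \<open>(s k + j) div t\<close>, which rise by at most one per step, stay between
\<open>p\<close> and \<open>q\<close>, and add up to \<open>s k\<close> by Hermite's identity.\<close>

lemma partial_sums_in_dilation:
  fixes M :: "('n::finite) matroid_data"
  assumes e: "inj_on e {1..n}" and ba: "bases M = (`) e ` path_sets n p q" and t: "t > 0"
    and s0: "s 0 = 0" and step: "\<And>k. s k \<le> s (Suc k) \<and> s (Suc k) \<le> s k + t"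
    and bound: "\<And>k. k \<le> n \<Longrightarrow> t * p k \<le> s k \<and> s k \<le> t * q k"
    and x0: "\<And>i. i \<notin> e ` {1..n} \<Longrightarrow> x $ i = 0"
    and xs: "\<And>k. k \<in> {1..n} \<Longrightarrow> x $ e k = real (s k) - real (s (k - 1))"
  shows "x \<in> (\<lambda>x. real t *\<^sub>R x) ` base_polytope M"
proof -
  define u where "u j k = (s k + j) div t" for j k
  have hu: "height_function (u j)" if "j < t" for j
    unfolding height_function_def
  proof (intro conjI allI)
    show "u j 0 = 0" using s0 that by (simp add: u_def)
    fix k
    have "u j k \<le> u j (Suc k)" using step[of k] by (simp add: u_def div_le_mono)
    moreover have "u j (Suc k) \<le> (s k + j + t) div t" using step[of k] by (auto simp: u_def intro: div_le_mono)
    moreover have "(s k + j + t) div t = Suc (u j k)" using t by (simp add: u_def)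
    ultimately show "u j (Suc k) = u j k \<or> u j (Suc k) = Suc (u j k)" by linarith
  qed
  have ub: "p k \<le> u j k \<and> u j k \<le> q k" if "j < t" "k \<le> n" for j k
  proof
    have "(t * p k) div t \<le> u j k" unfolding u_def using bound[OF that(2)] by (intro div_le_mono) auto
    then show "p k \<le> u j k" using t by simp
    have "u j k \<le> (j + t * q k) div t" unfolding u_def using bound[OF that(2)] by (intro div_le_mono) auto
    also have "\<dots> = q k" using t that(1) by simp
    finally show "u j k \<le> q k" .
  qed
  define B where "B j = e ` rises n (u j)" for j
  have Bb: "B j \<in> bases M" if "j < t" for j
    unfolding B_def ba using rises_in_path_sets[OF hu[OF that] ub[OF that]] by blast
  let ?y = "\<Sum>j<t. (1 / real t) *\<^sub>R incidence (B j)"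
  have "?y \<in> base_polytope M"
    unfolding base_polytope_def using t Bb
    by (intro convex_sum) (auto intro: hull_inc)
  moreover have "x = real t *\<^sub>R ?y"
  proof (rule vec_eq_iff[THEN iffD2], rule allI)
    fix i
    have y: "(real t *\<^sub>R ?y) $ i = (\<Sum>j<t. if i \<in> B j then 1 else 0)"
      using t by (simp add: sum_component incidence_nth[unfolded sum_component] sum_distrib_left)
    show "x $ i = (real t *\<^sub>R ?y) $ i"
    proof (cases "i \<in> e ` {1..n}")
      case False
      then have "i \<notin> B j" for j by (auto simp: B_def rises_def)
      then show ?thesis unfolding y using x0[OF False] by simp
    next
      case True
      then obtain k where k: "k \<in> {1..n}" "i = e k" by blast
      have "(if i \<in> B j then 1 else 0) = real (u j k) - real (u j (k - 1))" if "j < t" for j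
      proof -
        have "rises n (u j) \<subseteq> {1..n}" by (auto simp: rises_def)
        then have "i \<in> B j \<longleftrightarrow> k \<in> rises n (u j)"
          using e k unfolding B_def by (simp add: inj_on_image_mem_iff)
        also have "\<dots> \<longleftrightarrow> u j k = Suc (u j (k - 1))" using k by (simp add: rises_def)
        finally have iff: "i \<in> B j \<longleftrightarrow> u j k = Suc (u j (k - 1))" .
        have "u j (Suc (k - 1)) = u j (k - 1) \<or> u j (Suc (k - 1)) = Suc (u j (k - 1))"
          using hu[OF that] unfolding height_function_def by blast
        then show ?thesis using k iff by auto
      qed
      then have "(real t *\<^sub>R ?y) $ i = (\<Sum>j<t. real (u j k) - real (u j (k - 1)))"
        unfolding y by (intro sum.cong) auto
      also have "\<dots> = real (\<Sum>j<t. u j k) - real (\<Sum>j<t. u j (k - 1))"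
        by (simp add: sum_subtractf)
      also have "\<dots> = real (s k) - real (s (k - 1))"
        unfolding u_def sum_div_shift[OF t] ..
      finally show ?thesis using xs[OF k(1)] k(2) by simp
    qed
  qed
  ultimately show ?thesis by blast
qed

lemma sum_diff_telescope:
  "(\<Sum>i\<in>{1..k}. f i - f (i - 1)) = f k - (f 0 :: real)" for k :: nat
  by (induction k) auto

text \<open>Lattice points correspond to their partial sums, and subtracting \<open>t * p k\<close> leaves values in \<open>{0..t}\<close> at the
inner positions and 0 at both ends. The coordinate at \<open>k + 1\<close> is the difference of consecutive values if the
lower path goes east there, and \<open>t\<close> plus this difference if it goes north. That it lies in \<open>{0..t}\<close> means in the
first case that the values rise weakly, in the second that they fall weakly.\<close>

lemma card_dilation_points_snake:
  fixes M :: "('n::finite) matroid_data"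
  assumes n: "2 \<le> n" and e: "inj_on e {1..n}" and ba: "bases M = (`) e ` path_sets n p q"
    and p: "height_function p" and q: "height_function q" and pn: "p n = q n"
    and border: "\<forall>k\<in>{0<..<n}. q k = Suc (p k)" and t: "t > 0"
  shows "card (dilation_points M t) =
    card (order_maps (fence {i. p (Suc i) = Suc (p i)}) {1..<n} (Suc t))"
proof -
  let ?G = "{i. p (Suc i) = Suc (p i)}"
  let ?F = "order_maps (fence ?G) {1..<n} (Suc t)"
  have strip: "q k = Suc (p k)" if "0 < k" "k < n" for k using border that by simp
  have p0: "p 0 = 0" "q 0 = 0" using p q by (auto simp: height_function_def)
  have ps: "p (Suc j) = p j \<or> p (Suc j) = Suc (p j)" for j using p by (auto simp: height_function_def)
  have qs: "q (Suc j) = q j \<or> q (Suc j) = Suc (q j)" for j using q by (auto simp: height_function_def)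
  \<comment> \<open>The first step of the lower path is east and its last step is north, which makes the
    conditions at the two ends of the fence vacuous.\<close>
  have p1: "p 1 = 0" using strip[of 1] n qs[of 0] p0 by simp
  have pend: "p n = Suc (p (n - 1))"
    using strip[of "n - 1"] n ps[of "n - 1"] qs[of "n - 1"] pn by auto
  have inv: "inv_into {1..n} e (e i) = i" if "i \<in> {1..n}" for i using e that by simp
  define Y where "Y y k = (if k \<in> {1..<n} then y k else 0 :: nat)" for y :: "nat \<Rightarrow> nat" and k
  \<comment> \<open>The partial sums that belong to a filling, continued by a constant after position \<open>n\<close>.\<close>
  define s where "s y k = (if k \<le> n then Y y k + t * p k else t * p n)" for y k
  define X where "X y = (\<chi> i::'n. if i \<in> e ` {1..n} then
      real (s y (inv_into {1..n} e i)) - real (s y (inv_into {1..n} e i - 1)) else 0)" for y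
  define S where "S x k = (\<Sum>i\<in>{1..k}. x $ e i)" for x :: "real ^ 'n" and k
  \<comment> \<open>The inverse map, from lattice points to fillings.\<close>
  define Z where "Z x = (\<lambda>k\<in>{1..<n}. nat \<lfloor>S x k - real t * real (p k)\<rfloor>)" for x
  have Xe: "X y $ e k = real (s y k) - real (s y (k - 1))" if "k \<in> {1..n}" for y k
    using that inv[OF that] by (simp add: X_def)
  have X0: "X y $ i = 0" if "i \<notin> e ` {1..n}" for y i using that by (simp add: X_def)
  have s0: "s y 0 = 0" for y by (simp add: s_def Y_def p0)
  have SX: "S (X y) k = real (s y k)" if "k \<le> n" for y k
  proof -
    have "S (X y) k = (\<Sum>i\<in>{1..k}. real (s y i) - real (s y (i - 1)))"
      unfolding S_def using that by (intro sum.cong Xe) auto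
    also have "\<dots> = real (s y k)" by (subst sum_diff_telescope) (simp add: s0)
    finally show ?thesis .
  qed
  have ymono: "(p (Suc k) = p k \<longrightarrow> y k \<le> y (Suc k)) \<and> (p (Suc k) = Suc (p k) \<longrightarrow> y (Suc k) \<le> y k)"
    if "y \<in> ?F" "1 \<le> k" "Suc k < n" for y k
  proof -
    have o: "y i \<le> y j" if "i \<in> {1..<n}" "j \<in> {1..<n}" "(i, j) \<in> fence ?G" for i j
      using \<open>y \<in> ?F\<close> that by (auto simp: order_maps_def)
    show ?thesis using that(2,3) o[of k "Suc k"] o[of "Suc k" k] by (auto simp: fence_def)
  qed
  have yt: "y k \<le> t" if "y \<in> ?F" "k \<in> {1..<n}" for y k
    using that by (auto simp: order_maps_def PiE_def Pi_def less_Suc_eq_le)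
  have Yt: "Y y k \<le> t" if "y \<in> ?F" for y k using yt[OF that] by (simp add: Y_def)
  have sstep: "s y k \<le> s y (Suc k) \<and> s y (Suc k) \<le> s y k + t" if y: "y \<in> ?F" for y k
  proof -
    have "(p (Suc k) = p k \<longrightarrow> Y y k \<le> Y y (Suc k)) \<and> (p (Suc k) = Suc (p k) \<longrightarrow> Y y (Suc k) \<le> Y y k)"
      if kn: "Suc k \<le> n"
    proof -
      consider "k = 0" | "1 \<le> k" "Suc k < n" | "1 \<le> k" "Suc k = n" using kn by linarith
      then show ?thesis
      proof cases
        case 1
        then show ?thesis using p0 p1 n by (simp add: Y_def)
      next
        case 2
        then show ?thesis using ymono[OF y 2] by (simp add: Y_def)
      next
        case 3
        then show ?thesis using pend by (auto simp: Y_def)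
      qed
    qed
    then show ?thesis using ps[of k] Yt[OF y, of k] Yt[OF y, of "Suc k"]
      by (cases "Suc k \<le> n") (auto simp: s_def Y_def not_le less_Suc_eq_le algebra_simps)
  qed
  have sbound: "t * p k \<le> s y k \<and> s y k \<le> t * q k" if y: "y \<in> ?F" and k: "k \<le> n" for y k
  proof -
    consider "k = 0" | "0 < k" "k < n" | "k = n" using k by linarith
    then show ?thesis
    proof cases
      case 2
      then show ?thesis using strip[OF 2] Yt[OF y, of k] by (simp add: s_def)
    qed (use p0 pn in \<open>simp_all add: s_def Y_def\<close>)
  qed
  have XD: "X y \<in> dilation_points M t" if y: "y \<in> ?F" for y
    unfolding dilation_points_def
  proof
    show "X y \<in> (\<lambda>x. real t *\<^sub>R x) ` base_polytope M"
      by (rule partial_sums_in_dilation[OF e ba t s0 sstep[OF y] sbound[OF y] X0 Xe])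
    show "X y \<in> integer_points" by (simp add: integer_points_def X_def)
  qed
  have ZX: "Z (X y) = y" if y: "y \<in> ?F" for y
  proof
    fix k
    show "Z (X y) k = y k"
    proof (cases "k \<in> {1..<n}")
      case True
      then have "S (X y) k = real (y k) + real t * real (p k)"
        using SX[of k y] by (simp add: s_def Y_def)
      then show ?thesis using True by (simp add: Z_def)
    next
      case False
      then show ?thesis using y by (auto simp: Z_def order_maps_def PiE_def extensional_def)
    qed
  qed
  have Dprops: "(\<forall>i. i \<notin> e ` {1..n} \<longrightarrow> x $ i = 0)" "\<forall>i. 0 \<le> x $ i \<and> x $ i \<le> real t" "\<forall>i. x $ i \<in> \<int>"
    "\<forall>k\<le>n. real t * real (p k) \<le> S x k \<and> S x k \<le> real t * real (q k)"
    if D: "x \<in> dilation_points M t" for x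
  proof -
    obtain z where z: "z \<in> base_polytope M" "x = real t *\<^sub>R z" and xi: "x \<in> integer_points"
      using D by (auto simp: dilation_points_def)
    note b = base_polytope_path_sets[OF e ba z(1)]
    show "\<forall>i. x $ i \<in> \<int>" using xi by (simp add: integer_points_def)
    show "\<forall>i. i \<notin> e ` {1..n} \<longrightarrow> x $ i = 0" using b(1) z(2) by simp
    show "\<forall>i. 0 \<le> x $ i \<and> x $ i \<le> real t"
      using b(2,3) z(2) t by (simp add: mult_left_le)
    have "S x k = real t * S z k" for k by (simp add: S_def z(2) sum_distrib_left)
    then show "\<forall>k\<le>n. real t * real (p k) \<le> S x k \<and> S x k \<le> real t * real (q k)"
      using b(4,5) by (simp add: S_def mult_left_mono)
  qed
  have Zreal: "real (Z x k) = S x k - real t * real (p k)" if D: "x \<in> dilation_points M t" and k: "k \<in> {1..<n}" for x k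
  proof -
    have "S x k \<in> \<int>" unfolding S_def using Dprops(3)[OF D] by (intro Ints_sum) auto
    then have "S x k - real t * real (p k) \<in> \<int>" by (intro Ints_diff Ints_mult) auto
    moreover have "S x k - real t * real (p k) \<ge> 0" using Dprops(4)[OF D] k by auto
    ultimately show ?thesis using k by (auto simp: Z_def elim!: Ints_cases)
  qed
  have Sx: "x $ e (Suc k) = S x (Suc k) - S x k" for x k by (simp add: S_def)
  have ZF: "Z x \<in> ?F" if D: "x \<in> dilation_points M t" for x
    unfolding order_maps_def
  proof (intro CollectI conjI ballI impI)
    have "Z x k < Suc t" if k: "k \<in> {1..<n}" for k
    proof -
      have "S x k \<le> real t * real (q k)" using Dprops(4)[OF D] k by auto
      also have "\<dots> = real t * real (p k) + real t" using strip[of k] k by (simp add: algebra_simps)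
      finally show ?thesis using Zreal[OF D k] by simp
    qed
    then show "Z x \<in> {1..<n} \<rightarrow>\<^sub>E {..<Suc t}" by (auto simp: Z_def)
    fix i j assume ij: "i \<in> {1..<n}" "j \<in> {1..<n}" "(i, j) \<in> fence ?G"
    have xe: "0 \<le> x $ e (Suc k)" "x $ e (Suc k) \<le> real t" for k using Dprops(2)[OF D] by auto
    from ij(3) consider "j = Suc i" "p (Suc i) \<noteq> Suc (p i)" | "i = Suc j" "p (Suc j) = Suc (p j)"
      by (auto simp: fence_def)
    then have "real (Z x i) \<le> real (Z x j)"
    proof cases
      case 1
      then have "p j = p i" using ps[of i] by simp
      then show ?thesis unfolding Zreal[OF D ij(1)] Zreal[OF D ij(2)]
        using xe(1)[of i] Sx[of x i] 1(1) by simp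
    next
      case 2
      then show ?thesis unfolding Zreal[OF D ij(1)] Zreal[OF D ij(2)]
        using xe(2)[of j] Sx[of x j] by (simp add: algebra_simps)
    qed
    then show "Z x i \<le> Z x j" by simp
  qed
  have XZ: "X (Z x) = x" if D: "x \<in> dilation_points M t" for x
  proof (rule vec_eq_iff[THEN iffD2], rule allI)
    fix i
    have sS: "real (s (Z x) k) = S x k" if k: "k \<le> n" for k
    proof -
      consider "k = 0" | "k \<in> {1..<n}" | "k = n" using k by fastforce
      then show ?thesis
      proof cases
        case 1
        then show ?thesis by (simp add: s0 S_def)
      next
        case 2
        then show ?thesis using Zreal[OF D 2] by (simp add: s_def Y_def)
      next
        case 3
        have "real t * real (p n) \<le> S x n \<and> S x n \<le> real t * real (q n)" using Dprops(4)[OF D] by blast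
        then show ?thesis using 3 pn by (simp add: s_def Y_def)
      qed
    qed
    show "X (Z x) $ i = x $ i"
    proof (cases "i \<in> e ` {1..n}")
      case True
      then obtain k where k: "k \<in> {1..n}" "i = e k" by blast
      then have "k - 1 \<le> n" "k \<le> n" by auto
      then have "X (Z x) $ i = S x k - S x (k - 1)" using k Xe[OF k(1)] sS[of k] sS[of "k - 1"] by simp
      also have "\<dots> = x $ e k" using Sx[of x "k - 1"] k(1) by simp
      finally show ?thesis using k(2) by simp
    next
      case False
      then show ?thesis using X0 Dprops(1)[OF D] by simp
    qed
  qed
  have "bij_betw Z (dilation_points M t) ?F"
    by (rule bij_betw_byWitness[where f' = X]) (use XZ ZX XD ZF in blast)+
  then show ?thesis by (rule bij_betw_same_card)
qed

section \<open>Ehrhart polynomials of direct sums\<close>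

lemma base_polytope_nth_outside:
  assumes "\<forall>B\<in>bases M. B \<subseteq> ground M" "x \<in> base_polytope M" "i \<notin> ground M"
  shows "x $ i = 0"
proof -
  have "i \<notin> B" if "B \<in> bases M" for B using bspec[OF assms(1) that] assms(3) by blast
  then have "(\<lambda>B. incidence B) ` bases M \<subseteq> {x. x $ i = 0}"
    by (auto simp: incidence_nth[unfolded sum_component])
  moreover have "convex {x :: real ^ 'a. x $ i = 0}" by (auto simp: convex_def)
  ultimately have "base_polytope M \<subseteq> {x. x $ i = 0}"
    unfolding base_polytope_def by (rule hull_minimal)
  then show ?thesis using assms(2) by blast
qed

text \<open>Incidence vectors of disjoint unions add up, and convex hulls commute with Minkowski sums.\<close>

lemma base_polytope_direct_sum:
  assumes M: "\<forall>B\<in>bases M. B \<subseteq> ground M" and N: "\<forall>B\<in>bases N. B \<subseteq> ground N"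
    and disj: "ground M \<inter> ground N = {}"
  shows "base_polytope (direct_sum M N) = {x + y | x y. x \<in> base_polytope M \<and> y \<in> base_polytope N}"
proof -
  have add: "incidence (A \<union> B) = incidence A + incidence B" if "A \<in> bases M" "B \<in> bases N" for A B
    using bspec[OF M that(1)] bspec[OF N that(2)] disj by (intro sum.union_disjoint) auto
  have "(\<lambda>B. incidence B) ` bases (direct_sum M N) =
      (\<lambda>B. incidence B) ` bases M + (\<lambda>B. incidence B) ` bases N" (is "?L = ?R")
  proof -
    have "?L \<subseteq> ?R"
    proof (rule image_subsetI)
      fix C assume "C \<in> bases (direct_sum M N)"
      then obtain A B where "A \<in> bases M" "B \<in> bases N" "C = A \<union> B"
        by (auto simp: direct_sum_def)
      then show "incidence C \<in> ?R" using add[of A B] by (auto intro!: set_plus_intro)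
    qed
    moreover have "incidence A + incidence B \<in> ?L" if "A \<in> bases M" "B \<in> bases N" for A B
      using add[OF that] that by (intro image_eqI[of _ _ "A \<union> B"]) (auto simp: direct_sum_def)
    ultimately show ?thesis by (auto elim!: set_plus_elim)
  qed
  then show ?thesis
    unfolding base_polytope_def by (simp add: convex_hull_set_plus) (auto simp: set_plus_def)
qed

text \<open>The two summands of a point are its parts on the two ground sets, so they are determined by the point and are
integral if and only if the point is.\<close>

lemma card_dilation_points_direct_sum:
  fixes M N :: "('n::finite) matroid_data"
  assumes M: "\<forall>B\<in>bases M. B \<subseteq> ground M" and N: "\<forall>B\<in>bases N. B \<subseteq> ground N"
    and disj: "ground M \<inter> ground N = {}"
  shows "card (dilation_points (direct_sum M N) t) = card (dilation_points M t) * card (dilation_points N t)"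
proof -
  have out: "x $ i = 0" if "x \<in> (\<lambda>x. real t *\<^sub>R x) ` base_polytope L"
    "\<forall>B\<in>bases L. B \<subseteq> ground L" "i \<notin> ground L" for x i and L :: "'n matroid_data"
    using that(1) base_polytope_nth_outside[OF that(2) _ that(3)] by auto
  have outM: "x $ i = 0" if "x \<in> (\<lambda>x. real t *\<^sub>R x) ` base_polytope M" "i \<notin> ground M" for x i
    using out[OF that(1) M that(2)] .
  have outN: "x $ i = 0" if "x \<in> (\<lambda>x. real t *\<^sub>R x) ` base_polytope N" "i \<notin> ground N" for x i
    using out[OF that(1) N that(2)] .
  let ?P = "\<lambda>L. (\<lambda>x. real t *\<^sub>R x) ` base_polytope L"
  let ?f = "\<lambda>(x, y). x + y"
  have sum: "?P (direct_sum M N) = ?f ` (?P M \<times> ?P N)"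
    unfolding base_polytope_direct_sum[OF M N disj]
  proof
    show "(\<lambda>x. real t *\<^sub>R x) ` {x + y | x y. x \<in> base_polytope M \<and> y \<in> base_polytope N}
      \<subseteq> ?f ` (?P M \<times> ?P N)"
      by (force simp: scaleR_add_right)
    show "?f ` (?P M \<times> ?P N)
      \<subseteq> (\<lambda>x. real t *\<^sub>R x) ` {x + y | x y. x \<in> base_polytope M \<and> y \<in> base_polytope N}"
    proof (rule image_subsetI)
      fix w assume "w \<in> ?P M \<times> ?P N"
      then obtain x y where "x \<in> base_polytope M" "y \<in> base_polytope N"
        and w: "w = (real t *\<^sub>R x, real t *\<^sub>R y)" by blast
      moreover have "?f w = real t *\<^sub>R (x + y)" by (simp add: w scaleR_add_right)
      ultimately show "?f w \<in> (\<lambda>x. real t *\<^sub>R x) ` {x + y | x y. x \<in> base_polytope M \<and> y \<in> base_polytope N}"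
        by blast
    qed
  qed
  have comp: "x $ i = (if i \<in> ground M then z $ i else 0)"
    "y $ i = (if i \<in> ground M then 0 else z $ i)"
    if "x \<in> ?P M" "y \<in> ?P N" "z = x + y" for x y z i
    using outM[OF that(1), of i] outN[OF that(2), of i] that(3) disj by auto
  have "bij_betw ?f (dilation_points M t \<times> dilation_points N t) (dilation_points (direct_sum M N) t)"
    unfolding bij_betw_def
  proof
    show "inj_on ?f (dilation_points M t \<times> dilation_points N t)"
    proof (rule inj_onI, clarify)
      fix x y x' y'
      assume h: "x \<in> dilation_points M t" "y \<in> dilation_points N t"
        "x' \<in> dilation_points M t" "y' \<in> dilation_points N t" and eq: "x + y = x' + y'"
      have P: "x \<in> ?P M" "y \<in> ?P N" "x' \<in> ?P M" "y' \<in> ?P N"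
        using h unfolding dilation_points_def by blast+
      show "x = x' \<and> y = y'"
        unfolding vec_eq_iff comp[OF P(1,2) refl] comp[OF P(3,4) eq] by simp
    qed
    show "?f ` (dilation_points M t \<times> dilation_points N t) = dilation_points (direct_sum M N) t"
    proof
      show "?f ` (dilation_points M t \<times> dilation_points N t) \<subseteq> dilation_points (direct_sum M N) t"
        unfolding dilation_points_def sum by (auto simp: integer_points_def)
      show "dilation_points (direct_sum M N) t \<subseteq> ?f ` (dilation_points M t \<times> dilation_points N t)"
      proof
        fix z assume "z \<in> dilation_points (direct_sum M N) t"
        then have "z \<in> ?f ` (?P M \<times> ?P N)" and z: "z \<in> integer_points"
          unfolding dilation_points_def sum by (rule IntD1, rule IntD2)
        then obtain w where w: "w \<in> ?P M \<times> ?P N" "z = ?f w" by (elim imageE)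
        obtain x y where "w = (x, y)" by (cases w)
        then have xy: "x \<in> ?P M" "y \<in> ?P N" "z = x + y" using w by simp_all
        have zi: "z $ i \<in> \<int>" for i using z by (simp add: integer_points_def)
        have "x $ i \<in> \<int>" "y $ i \<in> \<int>" for i
          by (simp_all only: comp[OF xy] zi Ints_0 split: if_split) simp_all
        then have "x \<in> dilation_points M t" "y \<in> dilation_points N t"
          using xy(1,2) unfolding dilation_points_def integer_points_def by blast+
        then show "z \<in> ?f ` (dilation_points M t \<times> dilation_points N t)" using xy(3) by (intro image_eqI[of _ _ "(x, y)"]) simp_all
      qed
    qed
  qed
  from bij_betw_same_card[OF this] show ?thesis by (simp add: card_cartesian_product)
qed

definition nonneg_ehrhart :: "('n::finite) matroid_data \<Rightarrow> bool" where
  "nonneg_ehrhart M \<longleftrightarrow> (\<exists>p. is_ehrhart_polynomial (base_polytope M) p \<and> nonneg_poly p)"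

lemma is_ehrhart_polynomial_iff:
  "is_ehrhart_polynomial (base_polytope M) p \<longleftrightarrow>
    (\<forall>t::nat. t > 0 \<longrightarrow> poly p (of_nat t) = of_nat (card (dilation_points M t)))"
  by (simp add: is_ehrhart_polynomial_def dilation_points_def)

lemma nonneg_ehrhart_single_basis:
  assumes "bases M = {B}"
  shows "nonneg_ehrhart M"
proof -
  have "dilation_points M t = {real t *\<^sub>R incidence B}" for t
    by (auto simp: dilation_points_def base_polytope_def assms integer_points_def
        incidence_nth[unfolded sum_component])
  then show ?thesis
    unfolding nonneg_ehrhart_def is_ehrhart_polynomial_iff
    by (intro exI[of _ 1]) (simp add: nonneg_poly_1)
qed

lemma nonneg_ehrhart_direct_sum:
  assumes "\<forall>B\<in>bases M. B \<subseteq> ground M" "\<forall>B\<in>bases N. B \<subseteq> ground N"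
    and "ground M \<inter> ground N = {}" and "nonneg_ehrhart M" "nonneg_ehrhart N"
  shows "nonneg_ehrhart (direct_sum M N)"
proof -
  obtain p q where "is_ehrhart_polynomial (base_polytope M) p" "nonneg_poly p"
    "is_ehrhart_polynomial (base_polytope N) q" "nonneg_poly q"
    using assms(4,5) unfolding nonneg_ehrhart_def by blast
  then show ?thesis
    unfolding nonneg_ehrhart_def is_ehrhart_polynomial_iff
      card_dilation_points_direct_sum[OF assms(1-3)]
    by (intro exI[of _ "p * q"]) (simp add: nonneg_poly_mult)
qed

text \<open>The argument of the order polynomial is \<open>t + 1\<close> because the values of the fillings range over \<open>{0..t}\<close>.
Shifting the argument by one preserves nonnegativity of the coefficients.\<close>

lemma nonneg_ehrhart_snake:
  assumes "snake_matroid M"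
  shows "nonneg_ehrhart M"
proof -
  obtain n e p q where n: "2 \<le> n" "inj_on e {1..n}" and "ground M = e ` {1..n}"
    and pq: "bases M = (`) e ` path_sets n p q" "height_function p" "height_function q" "p n = q n"
    "\<forall>k\<in>{0<..<n}. q k = Suc (p k)"
    by (rule snake_matroid_paths[OF assms])
  obtain om where om: "is_order_polynomial (fence {i. p (Suc i) = Suc (p i)}) {1..<n} om" "nonneg_poly om"
    using fence_order_polynomial_nonneg[of "{1..<n}" "{i. p (Suc i) = Suc (p i)}"] by auto
  have "poly (pcompose om [:1, 1:]) (of_nat t) = of_nat (card (dilation_points M t))" if "t > 0" for t :: nat
  proof -
    have "poly (pcompose om [:1, 1:]) (of_nat t) = poly om (of_nat (Suc t))"
      by (simp add: poly_pcompose)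
    also have "\<dots> = of_nat (card (dilation_points M t))"
      using om(1) unfolding is_order_polynomial_def card_dilation_points_snake[OF n pq that] by blast
    finally show ?thesis .
  qed
  moreover have "nonneg_poly (pcompose om [:1, 1:])"
    by (rule nonneg_poly_pcompose[OF om(2)]) (simp add: nonneg_poly_pCons nonneg_poly_0)
  ultimately show ?thesis unfolding nonneg_ehrhart_def is_ehrhart_polynomial_iff by blast
qed

text \<open>The first two conclusions are carried along so that the ground set of each summand stays disjoint from
that of the sum of the later ones.\<close>

lemma nonneg_ehrhart_direct_sum_list:
  fixes Ns :: "('n::finite) matroid_data list"
  assumes "sorted_wrt (\<lambda>N N'. ground N \<inter> ground N' = {}) Ns"
    and "\<forall>N\<in>set Ns. (\<forall>B\<in>bases N. B \<subseteq> ground N) \<and> nonneg_ehrhart N"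
  shows "(\<forall>B\<in>bases (foldr direct_sum Ns empty_matroid). B \<subseteq> ground (foldr direct_sum Ns empty_matroid)) \<and>
    ground (foldr direct_sum Ns empty_matroid) = (\<Union>N\<in>set Ns. ground N) \<and>
    nonneg_ehrhart (foldr direct_sum Ns empty_matroid)"
  using assms
proof (induction Ns)
  case Nil
  then show ?case by (simp add: empty_matroid_def nonneg_ehrhart_single_basis)
next
  case (Cons N Ns)
  let ?L = "foldr direct_sum Ns empty_matroid"
  have "sorted_wrt (\<lambda>N N'. ground N \<inter> ground N' = {}) Ns"
    "\<forall>N\<in>set Ns. (\<forall>B\<in>bases N. B \<subseteq> ground N) \<and> nonneg_ehrhart N"
    using Cons.prems by simp_all
  from Cons.IH[OF this] have IH: "\<forall>B\<in>bases ?L. B \<subseteq> ground ?L"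
    "ground ?L = (\<Union>N\<in>set Ns. ground N)" "nonneg_ehrhart ?L" by blast+
  have N: "\<forall>B\<in>bases N. B \<subseteq> ground N" "nonneg_ehrhart N" using Cons.prems by simp_all
  have disj: "ground N \<inter> ground ?L = {}" using Cons.prems(1) IH(2) by auto
  have "nonneg_ehrhart (direct_sum N ?L)"
    by (rule nonneg_ehrhart_direct_sum[OF N(1) IH(1) disj N(2) IH(3)])
  moreover have "\<forall>B\<in>bases (direct_sum N ?L). B \<subseteq> ground (direct_sum N ?L)"
  proof
    fix C assume "C \<in> bases (direct_sum N ?L)"
    then obtain A B where "A \<in> bases N" "B \<in> bases ?L" "C = A \<union> B"
      by (auto simp: direct_sum_def)
    then have "A \<subseteq> ground N" "B \<subseteq> ground ?L" "C = A \<union> B" using N(1) IH(1) by simp_all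
    then show "C \<subseteq> ground (direct_sum N ?L)" by (auto simp: direct_sum_def)
  qed
  moreover have "ground (direct_sum N ?L) = (\<Union>N\<in>set (N # Ns). ground N)"
    using IH(2) by (simp add: direct_sum_def)
  ultimately show ?case by simp
qed

theorem corollary1p4:
  fixes M :: "('n::finite) matroid_data"
  assumes "matroid M"
    and "is_direct_sum_of M Ns"
    and "\<forall>N\<in>set Ns. is_loop N \<or> is_coloop N \<or> snake_matroid N"
  shows "ehrhart_positive (base_polytope M)"
proof -
  have "\<forall>N\<in>set Ns. (\<forall>B\<in>bases N. B \<subseteq> ground N) \<and> nonneg_ehrhart N"
  proof
    fix N assume "N \<in> set Ns"
    then have N: "is_loop N \<or> is_coloop N \<or> snake_matroid N" using assms(3) by blast
    show "(\<forall>B\<in>bases N. B \<subseteq> ground N) \<and> nonneg_ehrhart N"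
    proof (cases "snake_matroid N")
      case True
      then show ?thesis using nonneg_ehrhart_snake by (auto simp: snake_matroid_def matroid_def)
    next
      case False
      then obtain B where "bases N = {B}" "B \<subseteq> ground N"
        using N by (auto simp: is_loop_def is_coloop_def)
      then show ?thesis by (simp add: nonneg_ehrhart_single_basis)
    qed
  qed
  then have "nonneg_ehrhart M"
    using nonneg_ehrhart_direct_sum_list[of Ns] assms(2) by (simp add: is_direct_sum_of_def)
  then show ?thesis
    unfolding nonneg_ehrhart_def ehrhart_positive_def nonneg_poly_def
    using ehrhart_polynomial_eqI by metis
qed

end
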